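(* Let $\pi = \oplus[\xi_1, \ldots, \xi_r]$ (with $r \geq 2$) where every $\xi_i$ is an increasing oscillation. Then the set $P(\pi)$ of pin words encoding $\pi$ is $$P(\pi) = \bigcup_{1\leq i \leq r-1} P(\oplus[\xi_i,\xi_{i+1}]) \cdot \operatorname{Sh}\Big( \big(P^{(1)}(\xi_{i-1}) , \ldots , P^{(1)}(\xi_1) \big) ,\ \big(P^{(3)}(\xi_{i+2}) , \ldots , P^{(3)}(\xi_r) \big) \Big),$$ where $\operatorname{Sh}$ denotes the shuffle product of sequences of sets of words defined below.
   Context: Pin words are words over the alphabet $\{1,2,3,4,U,D,L,R\}$ encoding pin representations of permutations (sequences of points in which each new point lies outside the bounding box of the previous ones and either separates the last point from the earlier ones, encoded by a direction $U,D,L,R$, or is independent of them, encoded by the numeral $1,2,3,4$ of the quadrant it lies in, relative to an origin point $p_0$). For a permutation $\sigma$, $P(\sigma)$ is the set of pin words encoding $\sigma$. $\oplus[\pi_1,\ldots,\pi_k]$ denotes the substitution (inflation) of $\pi_1,\ldots,\pi_k$ into the identity permutation $12\ldots k$. An increasing oscillation is a permutation among $1, 21, 231, 312$, or, for size $n\geq 4$, a simple permutation of size $n$ contained as a pattern in the infinite sequence $3\,1\,5\,2\,7\,4\,9\,6\ldots(2k+1)\,(2k-2)\ldots$. For an increasing oscillation $\xi$ and $h \in \{1,3\}$, $P^{(h)}(\xi)$ denotes the set of pin words encoding $\xi$ whose origin lies in quadrant $h$ with respect to the bounding box of the points of $\xi$. Concatenation of sets of words is $X\cdot Y = \{xy :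 x\in X, y\in Y\}$. For sequences of sets of words ${\mathsf A} = ({\mathsf A}_1,\ldots,{\mathsf A}_q)$ and ${\mathsf B} = ({\mathsf B}_1,\ldots,{\mathsf B}_s)$, the shuffle product $\operatorname{Sh}({\mathsf A},{\mathsf B})$ is the set of words $c = c_1 c_2\cdots c_{q+s}$ such that there exist disjoint index sets $I=\{i_1<\ldots<i_q\}$ and $J=\{j_1<\ldots<j_s\}$ with $I\cup J=\{1,\ldots,q+s\}$, $c_{i_k}\in{\mathsf A}_k$ for all $k\leq q$ and $c_{j_k}\in{\mathsf B}_k$ for all $k\leq s$. Empty sequences (e.g. when $i=1$ or $i+2>r$) contribute nothing. *)

theory Defs
  imports Complex_Main "HOL-Combinatorics.Multiset_Permutations"
begin

text \<open>Permutations of \<open>{1..n}\<close> are given in one-line notation, as lists.\<close>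

definition is_perm :: "nat list \<Rightarrow> bool" where
  "is_perm \<sigma> \<longleftrightarrow> \<sigma> \<in> permutations_of_set {1..length \<sigma>}"

text \<open>The substitution \<open>\<sigma>[\<pi>\<^sub>1, \<dots>, \<pi>\<^sub>k]\<close>, for \<open>\<sigma>\<close> of size \<open>k\<close>: the block replacing the entry at
  position \<open>i\<close> is shifted above all blocks that replace smaller entries.\<close>

definition inflate :: "nat list \<Rightarrow> nat list list \<Rightarrow> nat list" where
  "inflate \<sigma> \<pi>s = concat (map
     (\<lambda>i. map (\<lambda>v. v + (\<Sum>j | j < length \<sigma> \<and> \<sigma> ! j < \<sigma> ! i. length (\<pi>s ! j))) (\<pi>s ! i))
     [0..<length \<sigma>])"

definition direct_sum :: "nat list list \<Rightarrow> nat list" where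
  "direct_sum \<pi>s = inflate [1..<length \<pi>s + 1] \<pi>s"

text \<open>Simple: the only intervals are the singletons and the whole permutation.\<close>

definition simple_perm :: "nat list \<Rightarrow> bool" where
  "simple_perm \<sigma> \<longleftrightarrow> is_perm \<sigma> \<and>
     (\<forall>i j. i < j \<and> j < length \<sigma> \<and> (\<exists>a b. (!) \<sigma> ` {i..j} = {a..b})
        \<longrightarrow> i = 0 \<and> j = length \<sigma> - 1)"

text \<open>The sequence \<open>3 1 5 2 7 4 9 6 \<dots>\<close>, indexed from 0.\<close>

definition osc_seq :: "nat \<Rightarrow> nat" where
  "osc_seq n = (if even n then n + 3 else if n = 1 then 1 else n - 1)"

definition pattern_of_seq :: "nat list \<Rightarrow> (nat \<Rightarrow> nat) \<Rightarrow> bool" where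
  "pattern_of_seq \<sigma> f \<longleftrightarrow> (\<exists>\<iota>. strict_mono_on {..<length \<sigma>} \<iota> \<and>
     (\<forall>i<length \<sigma>. \<forall>j<length \<sigma>. \<sigma> ! i < \<sigma> ! j \<longleftrightarrow> f (\<iota> i) < f (\<iota> j)))"

definition increasing_oscillation :: "nat list \<Rightarrow> bool" where
  "increasing_oscillation \<sigma> \<longleftrightarrow> \<sigma> \<in> {[1], [2,1], [2,3,1], [3,1,2]} \<or>
     (length \<sigma> \<ge> 4 \<and> simple_perm \<sigma> \<and> pattern_of_seq \<sigma> osc_seq)"


type_synonym point = "real \<times> real"

definition diagram :: "nat list \<Rightarrow> point set" where
  "diagram \<sigma> = {(real (i + 1), real (\<sigma> ! i)) | i. i < length \<sigma>}"

text \<open>Bounding box of a finite nonempty set of points.\<close>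

definition bbox :: "point set \<Rightarrow> point set" where
  "bbox S = {Min (fst ` S)..Max (fst ` S)} \<times> {Min (snd ` S)..Max (snd ` S)}"

text \<open>The vertical or the horizontal line through \<open>p\<close> separates \<open>q\<close> from \<open>S\<close>.\<close>

definition separates :: "point \<Rightarrow> point \<Rightarrow> point set \<Rightarrow> bool" where
  "separates p q S \<longleftrightarrow>
     (fst q < fst p \<and> (\<forall>s\<in>S. fst p < fst s)) \<or> (fst p < fst q \<and> (\<forall>s\<in>S. fst s < fst p)) \<or>
     (snd q < snd p \<and> (\<forall>s\<in>S. snd p < snd s)) \<or> (snd p < snd q \<and> (\<forall>s\<in>S. snd s < snd p))"

text \<open>Neither the vertical nor the horizontal line through \<open>p\<close> meets the bounding box of \<open>S\<close>.\<close>

definition pin_independent :: "point \<Rightarrow> point set \<Rightarrow> bool" where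
  "pin_independent p S \<longleftrightarrow> fst p \<notin> fst ` bbox S \<and> snd p \<notin> snd ` bbox S"

text \<open>Separating the last point from the earlier ones only makes sense if there are earlier
  ones, hence the condition \<open>2 \<le> i\<close> (points are indexed from 0).\<close>

definition separating_pin :: "point list \<Rightarrow> nat \<Rightarrow> bool" where
  "separating_pin ps i \<longleftrightarrow> 2 \<le> i \<and> separates (ps ! i) (ps ! (i - 1)) (set (take (i - 1) ps))"

definition independent_pin :: "point list \<Rightarrow> nat \<Rightarrow> bool" where
  "independent_pin ps i \<longleftrightarrow> pin_independent (ps ! i) (set (take i ps))"

definition pin_sequence :: "point list \<Rightarrow> bool" where
  "pin_sequence ps \<longleftrightarrow> (\<forall>i. 1 \<le> i \<and> i < length ps \<longrightarrow>
     ps ! i \<notin> bbox (set (take i ps)) \<and> (separating_pin ps i \<or> independent_pin ps i))"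

definition pin_representation :: "point list \<Rightarrow> nat list \<Rightarrow> bool" where
  "pin_representation ps \<sigma> \<longleftrightarrow> distinct ps \<and> set ps = diagram \<sigma> \<and> pin_sequence ps"


datatype quadrant = Q1 | Q2 | Q3 | Q4
datatype direction = Up | Down | Left | Right
datatype letter = Num quadrant | Dir direction

text \<open>The position of \<open>p\<close> with respect to the bounding box of \<open>S\<close>; for \<open>S = {q}\<close> these are the
  usual open quadrants around \<open>q\<close>.\<close>

fun in_quadrant :: "quadrant \<Rightarrow> point set \<Rightarrow> point \<Rightarrow> bool" where
  "in_quadrant Q1 S p \<longleftrightarrow> (\<forall>s\<in>S. fst s < fst p \<and> snd s < snd p)"
| "in_quadrant Q2 S p \<longleftrightarrow> (\<forall>s\<in>S. fst p < fst s \<and> snd s < snd p)"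
| "in_quadrant Q3 S p \<longleftrightarrow> (\<forall>s\<in>S. fst p < fst s \<and> snd p < snd s)"
| "in_quadrant Q4 S p \<longleftrightarrow> (\<forall>s\<in>S. fst s < fst p \<and> snd p < snd s)"

fun in_direction :: "direction \<Rightarrow> point set \<Rightarrow> point \<Rightarrow> bool" where
  "in_direction Up S p \<longleftrightarrow> (\<forall>s\<in>S. snd s < snd p)"
| "in_direction Down S p \<longleftrightarrow> (\<forall>s\<in>S. snd p < snd s)"
| "in_direction Left S p \<longleftrightarrow> (\<forall>s\<in>S. fst p < fst s)"
| "in_direction Right S p \<longleftrightarrow> (\<forall>s\<in>S. fst s < fst p)"

text \<open>The letter encoding the point \<open>ps ! i\<close> (\<open>i \<ge> 1\<close>) of a pin sequence with origin \<open>ps ! 0\<close>.\<close>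

fun encodes_pin :: "point list \<Rightarrow> nat \<Rightarrow> letter \<Rightarrow> bool" where
  "encodes_pin ps i (Num h) \<longleftrightarrow> independent_pin ps i \<and> in_quadrant h {ps ! 0} (ps ! i)"
| "encodes_pin ps i (Dir d) \<longleftrightarrow> separating_pin ps i \<and> in_direction d (set (take i ps)) (ps ! i)"

text \<open>\<open>w\<close> encodes the pin representation \<open>ps\<close> of \<open>\<sigma>\<close> with respect to the origin \<open>p0\<close>, where the
  origin has to extend \<open>ps\<close> to a pin sequence.  (General position of the origin is automatic,
  since separation, independence and quadrants are strict.)\<close>

definition pin_word_of :: "nat list \<Rightarrow> point \<Rightarrow> point list \<Rightarrow> letter list \<Rightarrow> bool" where
  "pin_word_of \<sigma> p0 ps w \<longleftrightarrow>
     pin_representation ps \<sigma> \<and> pin_sequence (p0 # ps) \<and> length w = length ps \<and>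
     (\<forall>i<length w. encodes_pin (p0 # ps) (i + 1) (w ! i))"

definition pin_words :: "nat list \<Rightarrow> letter list set" where
  "pin_words \<sigma> = {w. \<exists>p0 ps. pin_word_of \<sigma> p0 ps w}"

definition pin_words_quadrant :: "quadrant \<Rightarrow> nat list \<Rightarrow> letter list set" where
  "pin_words_quadrant h \<sigma> =
     {w. \<exists>p0 ps. in_quadrant h (diagram \<sigma>) p0 \<and> pin_word_of \<sigma> p0 ps w}"


definition conc :: "'a list set \<Rightarrow> 'a list set \<Rightarrow> 'a list set" (infixr "\<cdot>" 75) where
  "X \<cdot> Y = {x @ y | x y. x \<in> X \<and> y \<in> Y}"

text \<open>\<open>nths c I\<close> is \<open>[c\<^bsub>i\<^sub>1\<^esub>, \<dots>, c\<^bsub>i\<^sub>q\<^esub>]\<close> for \<open>I = {i\<^sub>1 < \<dots> < i\<^sub>q}\<close>.\<close>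

definition shuffle_product :: "'a list set list \<Rightarrow> 'a list set list \<Rightarrow> 'a list set" where
  "shuffle_product A B = {concat c | c. length c = length A + length B \<and>
     (\<exists>I J. I \<inter> J = {} \<and> I \<union> J = {..<length c} \<and>
        list_all2 (\<in>) (nths c I) A \<and> list_all2 (\<in>) (nths c J) B)}"

end

theory Submission
  imports Defs
begin

text \<open>
  Only the sum-indecomposability of the blocks \<open>\<xi>\<^sub>i\<close> matters.  Let \<open>p\<^sub>k\<close> be an independent pin of a
  pin sequence of \<open>\<pi>\<close>, read when two blocks have been met already, and let \<open>B\<close> be the set of the
  origin and the earlier points.  Every point read from then on avoids both strips spanned by \<open>B\<close>:
  an independent pin does so outright, and a separating pin separates the previous point from
  \<open>B\<close>.  As \<open>B\<close> meets two blocks, these points lie in quadrant 1 or 3 of \<open>B\<close>, and a block met by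
  \<open>B\<close> but not contained in it would be sum-decomposable.  So \<open>B\<close> is a union of blocks, and with
  \<open>p\<^sub>k\<close> the last independent pin the rest of the sequence is one block, necessarily \<open>\<xi>\<^sub>1\<close> or \<open>\<xi>\<^sub>r\<close>.
  Such a \<open>p\<^sub>k\<close> exists as soon as \<open>r \<ge> 3\<close>, since separating pins alone never leave the
  first two blocks.  This yields the recursion
  \<open>P(\<oplus>[\<xi>\<^sub>1, \<dots>, \<xi>\<^sub>r]) = P(\<oplus>[\<xi>\<^sub>2, \<dots>, \<xi>\<^sub>r]) \<cdot> P\<^sup>1(\<xi>\<^sub>1) \<union> P(\<oplus>[\<xi>\<^sub>1, \<dots>, \<xi>\<^sub>r\<^sub>-\<^sub>1]) \<cdot> P\<^sup>3(\<xi>\<^sub>r)\<close>,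
  which is also the recursion of the shuffle product on the last factor.
\<close>

section \<open>Pin words of point sets\<close>

text \<open>In \<open>pin_step\<close>, \<open>qs\<close> lists the origin and the points read before \<open>p\<close>.\<close>

definition pin_step :: "point list \<Rightarrow> point \<Rightarrow> letter \<Rightarrow> bool" where
  "pin_step qs p l \<longleftrightarrow> (case l of
     Num h \<Rightarrow> pin_independent p (set qs) \<and> in_quadrant h {hd qs} p
   | Dir d \<Rightarrow> 2 \<le> length qs \<and> separates p (last qs) (set (butlast qs)) \<and> in_direction d (set qs) p)"

text \<open>The prefix \<open>qs\<close> is a parameter so that a run can be cut anywhere and its
  tail is again a run, started from everything read before.\<close>

definition pin_run :: "point list \<Rightarrow> point list \<Rightarrow> letter list \<Rightarrow> bool" where
  "pin_run qs ps w \<longleftrightarrow> length w = length ps \<and>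
     (\<forall>i<length ps. pin_step (qs @ take i ps) (ps ! i) (w ! i))"

text \<open>Defined for point sets rather than permutations, because removing a block from a diagram
  may leave a set that is not itself a diagram.\<close>

definition set_words :: "point set \<Rightarrow> letter list set" where
  "set_words D = {w. \<exists>p0 ps. set ps = D \<and> pin_run [p0] ps w}"

text \<open>The quadrant is that of the points seen from the origin, hence opposite to the quadrant of the
  origin in \<open>pin_words_quadrant\<close>.\<close>

definition set_words_from :: "quadrant \<Rightarrow> point set \<Rightarrow> letter list set" where
  "set_words_from h D =
     {w. \<exists>p0 ps. (\<forall>p\<in>D. in_quadrant h {p0} p) \<and> set ps = D \<and> pin_run [p0] ps w}"

text \<open>Index \<open>i\<close> becomes the prefix of length \<open>i\<close>: the origin is its
  head, the previous pin its last element, and the earlier points form its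
  \<open>butlast\<close>.\<close>

lemma encodes_pin_iff:
  assumes "1 \<le> i" "i < length qs"
  shows "encodes_pin qs i l \<longleftrightarrow> pin_step (take i qs) (qs ! i) l"
proof -
  have "hd (take i qs) = qs ! 0"
    using assms by (cases qs; cases i) auto
  moreover have "last (take i qs) = qs ! (i - 1)"
    using assms by (subst last_conv_nth) auto
  moreover have "butlast (take i qs) = take (i - 1) qs"
    using assms by (simp add: butlast_take)
  ultimately show ?thesis
    using assms by (cases l) (auto simp: pin_step_def independent_pin_def separating_pin_def)
qed

section \<open>Bounding boxes, quadrants and single pins\<close>

lemma fst_bbox:
  assumes "finite S" "S \<noteq> {}"
  shows "fst p \<in> fst ` bbox S \<longleftrightarrow> (\<exists>s\<in>S. fst s \<le> fst p) \<and> (\<exists>s\<in>S. fst p \<le> fst s)"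
proof -
  \<comment> \<open>The projection of the box is the full interval only if the other side of the box
    is nonempty.\<close>
  have "Min (snd ` S) \<le> Max (snd ` S)"
    using assms by (meson Max_in Min_le finite_imageI image_is_empty)
  then have "fst ` bbox S = {Min (fst ` S)..Max (fst ` S)}"
    by (simp add: bbox_def)
  then show ?thesis
    using assms by (auto simp: Min_le_iff Max_ge_iff)
qed

lemma snd_bbox:
  assumes "finite S" "S \<noteq> {}"
  shows "snd p \<in> snd ` bbox S \<longleftrightarrow> (\<exists>s\<in>S. snd s \<le> snd p) \<and> (\<exists>s\<in>S. snd p \<le> snd s)"
proof -
  have "Min (fst ` S) \<le> Max (fst ` S)"
    using assms by (meson Max_in Min_le finite_imageI image_is_empty)
  then have "snd ` bbox S = {Min (snd ` S)..Max (snd ` S)}"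
    by (simp add: bbox_def)
  then show ?thesis
    using assms by (auto simp: Min_le_iff Max_ge_iff)
qed

lemma mem_bbox:
  assumes "finite S" "S \<noteq> {}"
  shows "p \<in> bbox S \<longleftrightarrow> (\<exists>s\<in>S. fst s \<le> fst p) \<and> (\<exists>s\<in>S. fst p \<le> fst s) \<and>
    (\<exists>s\<in>S. snd s \<le> snd p) \<and> (\<exists>s\<in>S. snd p \<le> snd s)"
  using assms by (cases p) (auto simp: bbox_def Min_le_iff Max_ge_iff)

text \<open>A line misses the box iff the set lies strictly on one side of it; the choices of side
  on the two axes give the four quadrants.\<close>

lemma pin_independent_iff:
  assumes "finite S" "S \<noteq> {}"
  shows "pin_independent p S \<longleftrightarrow> (\<exists>h. in_quadrant h S p)"
proof -
  have "pin_independent p S \<longleftrightarrow> ((\<forall>s\<in>S. fst s < fst p) \<or> (\<forall>s\<in>S. fst p < fst s)) \<and>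
    ((\<forall>s\<in>S. snd s < snd p) \<or> (\<forall>s\<in>S. snd p < snd s))"
    unfolding pin_independent_def fst_bbox[OF assms] snd_bbox[OF assms] by (meson not_le)
  also have "\<dots> \<longleftrightarrow> (\<exists>h. in_quadrant h S p)" (is "?L \<longleftrightarrow> ?R")
  proof
    assume ?L
    then show ?R
      by (metis in_quadrant.simps)
  next
    assume ?R
    then obtain h where "in_quadrant h S p" ..
    then show ?L by (cases h) auto
  qed
  finally show ?thesis .
qed

lemma in_quadrant_mono: "in_quadrant h T p \<Longrightarrow> S \<subseteq> T \<Longrightarrow> in_quadrant h S p"
  by (cases h) auto

lemma in_quadrant_not_bbox:
  assumes "in_quadrant h S p" "finite S" "S \<noteq> {}"
  shows "p \<notin> bbox S"
  using assms by (cases h) (force simp: mem_bbox)+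

text \<open>Independence yields some quadrant of the whole prefix; the origin belongs to the prefix,
  so it is the quadrant named by the numeral.\<close>

lemma pin_step_quadrant:
  assumes "pin_step qs p (Num h)" "qs \<noteq> []"
  shows "in_quadrant h (set qs) p"
proof -
  obtain h' where h': "in_quadrant h' (set qs) p"
    using assms by (auto simp: pin_step_def pin_independent_iff)
  then have "in_quadrant h' {hd qs} p"
    using assms(2) by (intro in_quadrant_mono[OF h']) auto
  moreover have "in_quadrant h {hd qs} p"
    using assms by (simp add: pin_step_def)
  ultimately have "h = h'"
    by (cases h; cases h') auto
  with h' show ?thesis by simp
qed

text \<open>For a direction, the separating line has the last point on one side and the earlier
  points on the other, so the direction must refer to the other axis. Separation controls one
  coordinate of \<open>p\<close>, the direction the other, and \<open>p\<close> avoids both strips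
  spanned by the earlier points.\<close>

lemma pin_step_quadrant_butlast:
  assumes "pin_step qs p l" "qs \<noteq> []"
  shows "\<exists>h. in_quadrant h (set (butlast qs)) p"
proof (cases l)
  case (Num h)
  then show ?thesis
    using pin_step_quadrant[of qs p h] assms in_quadrant_mono in_set_butlastD
    by (metis subsetI)
next
  case (Dir d)
  let ?S = "set (butlast qs)"
  have sep: "separates p (last qs) ?S" and dir: "in_direction d (set qs) p" and "2 \<le> length qs"
    using assms Dir by (auto simp: pin_step_def)
  have "set qs = insert (last qs) ?S"
    using assms(2) by (metis append_butlast_last_id list.set(1,2) set_append Un_insert_right Un_empty_right)
  then have dir': "in_direction d {last qs} p" "in_direction d ?S p"
    using dir by (cases d; simp)+
  have "?S \<noteq> {}"
    using \<open>2 \<le> length qs\<close> by (cases qs rule: rev_cases; cases "butlast qs") auto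
  then obtain s where "s \<in> ?S" by (meson ex_in_conv)
  have "((\<forall>s\<in>?S. fst s < fst p) \<or> (\<forall>s\<in>?S. fst p < fst s)) \<and>
    ((\<forall>s\<in>?S. snd s < snd p) \<or> (\<forall>s\<in>?S. snd p < snd s))"
    using sep dir' \<open>s \<in> ?S\<close> unfolding separates_def
    by (cases d; simp only: in_direction.simps) (meson less_asym singletonI)+
  then show ?thesis
    by (metis in_quadrant.simps)
qed

lemma pin_step_not_bbox:
  assumes "pin_step qs p l" "qs \<noteq> []"
  shows "p \<notin> bbox (set qs)"
proof (cases l)
  case (Num h)
  then show ?thesis
    using pin_step_quadrant assms in_quadrant_not_bbox by (metis List.finite_set set_empty)
next
  case (Dir d)
  then have "in_direction d (set qs) p"
    using assms by (simp add: pin_step_def)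
  then show ?thesis
    using assms(2) by (cases d) (force simp: mem_bbox)+
qed

lemma bbox_mono:
  assumes "finite T" "S \<subseteq> T" "S \<noteq> {}"
  shows "bbox S \<subseteq> bbox T"
proof
  fix p
  have "finite S" "T \<noteq> {}"
    using assms finite_subset by auto
  moreover assume "p \<in> bbox S"
  ultimately show "p \<in> bbox T"
    using assms by (simp add: mem_bbox) (meson subsetD)
qed

lemma separates_mono: "separates p q T \<Longrightarrow> S \<subseteq> T \<Longrightarrow> separates p q S"
  unfolding separates_def by blast

text \<open>A repeated point would lie in the bounding box of the prefix that contains it.\<close>

lemma pin_run_distinct:
  assumes "pin_run qs ps w" "qs \<noteq> []"
  shows "distinct ps"
proof -
  have "ps ! i \<noteq> ps ! j" if "i < j" "j < length ps" for i j
  proof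
    assume "ps ! i = ps ! j"
    then have "ps ! j \<in> set (qs @ take j ps)"
      using that by (auto simp: in_set_conv_nth intro!: exI[of _ i])
    then have "ps ! j \<in> bbox (set (qs @ take j ps))"
      using assms(2) by (subst mem_bbox) auto
    moreover have "pin_step (qs @ take j ps) (ps ! j) (w ! j)"
      using assms that by (auto simp: pin_run_def)
    ultimately show False
      using pin_step_not_bbox assms(2) by blast
  qed
  then show ?thesis
    by (metis distinct_conv_nth linorder_neqE_nat)
qed

text \<open>The letters alone force a pin sequence: each of them keeps its pin outside the bounding box.\<close>

lemma pin_word_of_iff:
  assumes "distinct \<sigma>"
  shows "pin_word_of \<sigma> p0 ps w \<longleftrightarrow> set ps = diagram \<sigma> \<and> pin_run [p0] ps w"
proof -
  have enc: "(\<forall>i<length w. encodes_pin (p0 # ps) (i + 1) (w ! i)) \<longleftrightarrow>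
    (\<forall>i<length ps. pin_step ([p0] @ take i ps) (ps ! i) (w ! i))" if "length w = length ps"
    using that by (simp add: encodes_pin_iff)
  have seq: "pin_sequence ps" "pin_sequence (p0 # ps)"
    if run: "pin_run [p0] ps w" and D: "set ps = diagram \<sigma>"
  proof -
    have st: "pin_step (p0 # take i ps) (ps ! i) (w ! i)" if "i < length ps" for i
      using run that by (simp add: pin_run_def)
    have cases: "separating_pin (p0 # ps) (Suc i) \<or> independent_pin (p0 # ps) (Suc i)"
      if "i < length ps" for i
      using st[OF that] that encodes_pin_iff[of "Suc i" "p0 # ps" "w ! i"]
      by (cases "w ! i") auto
    show "pin_sequence (p0 # ps)"
      unfolding pin_sequence_def
    proof (intro allI impI, goal_cases)
      case (1 i)
      then obtain j where "i = Suc j" "j < length ps" by (cases i) auto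
      then show ?case
        using cases[of j] pin_step_not_bbox[OF st[of j]] by auto
    qed
    show "pin_sequence ps"
      unfolding pin_sequence_def
    proof (intro allI impI, goal_cases)
      case (1 i)
      let ?S = "set (take i ps)"
      have i: "1 \<le> i" "i < length ps" and ne: "?S \<noteq> {}"
        using 1 by auto
      have nb: "ps ! i \<notin> bbox ?S"
        using pin_step_not_bbox[OF st[OF i(2)]] bbox_mono[of "set (p0 # take i ps)" ?S] ne
        by auto
      consider "separating_pin (p0 # ps) (Suc i)" "i = 1" | "separating_pin (p0 # ps) (Suc i)" "2 \<le> i"
        | "independent_pin (p0 # ps) (Suc i)"
        using cases[OF i(2)] i by linarith
      then have "separating_pin ps i \<or> independent_pin ps i"
      proof cases
        \<comment> \<open>In \<open>ps\<close> alone this pin has a single predecessor, while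
          separation asks for two. It is independent instead: distinct points of the diagram share
          no coordinate, as the entries of \<sigma> are distinct.\<close>
        case 1
        have "ps ! 0 \<noteq> ps ! 1"
          using pin_run_distinct[OF run] i 1 by (subst nth_eq_iff_index_eq) auto
        moreover have "ps ! 0 \<in> diagram \<sigma>" "ps ! 1 \<in> diagram \<sigma>"
          using i 1 D by (metis nth_mem less_trans zero_less_one)+
        ultimately have "fst (ps ! 0) \<noteq> fst (ps ! 1)" "snd (ps ! 0) \<noteq> snd (ps ! 1)"
          using assms by (auto simp: diagram_def nth_eq_iff_index_eq)
        moreover have "?S = {ps ! 0}"
          using 1 i by (cases ps) auto
        ultimately have "independent_pin ps i"
          using 1 by (auto simp: independent_pin_def pin_independent_def fst_bbox snd_bbox)
        then show ?thesis ..
      next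
        case 2
        then have "separates (ps ! i) (ps ! (i - 1)) (set (take i (p0 # ps)))"
          by (simp add: separating_pin_def)
        moreover have "set (take (i - 1) ps) \<subseteq> set (take i (p0 # ps))"
          using i by (cases i) auto
        ultimately show ?thesis
          using 2 separates_mono by (auto simp: separating_pin_def)
      next
        case 3
        then have "pin_independent (ps ! i) (set (p0 # take i ps))"
          by (simp add: independent_pin_def)
        then have "pin_independent (ps ! i) ?S"
          using ne in_quadrant_mono[of _ "set (p0 # take i ps)" "ps ! i" ?S]
          by (metis List.finite_set list.distinct(1) pin_independent_iff set_empty set_subset_Cons)
        then show ?thesis
          by (simp add: independent_pin_def)
      qed
      with nb show ?case by simp
    qed
  qed
  show ?thesis
  proof
    assume "pin_word_of \<sigma> p0 ps w"
    then show "set ps = diagram \<sigma> \<and> pin_run [p0] ps w"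
      using enc by (simp add: pin_word_of_def pin_representation_def pin_run_def)
  next
    assume "set ps = diagram \<sigma> \<and> pin_run [p0] ps w"
    then show "pin_word_of \<sigma> p0 ps w"
      using enc seq pin_run_distinct[of "[p0]" ps w]
      by (simp add: pin_word_of_def pin_representation_def pin_run_def)
  qed
qed

lemma pin_words_eq: "distinct \<sigma> \<Longrightarrow> pin_words \<sigma> = set_words (diagram \<sigma>)"
  by (auto simp: pin_words_def set_words_def pin_word_of_iff)

lemma pin_words_quadrant_Q1: "distinct \<sigma> \<Longrightarrow> pin_words_quadrant Q1 \<sigma> = set_words_from Q3 (diagram \<sigma>)"
  and pin_words_quadrant_Q3: "distinct \<sigma> \<Longrightarrow> pin_words_quadrant Q3 \<sigma> = set_words_from Q1 (diagram \<sigma>)"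
  by (auto simp: pin_words_quadrant_def set_words_from_def pin_word_of_iff)

section \<open>Changing the origin of a run\<close>

lemma in_quadrant_unique: "in_quadrant h S p \<Longrightarrow> in_quadrant h' S p \<Longrightarrow> S \<noteq> {} \<Longrightarrow> h = h'"
  by (cases h; cases h') (auto dest: less_asym)

lemma pin_step_Num_iff:
  assumes "qs \<noteq> []"
  shows "pin_step qs p (Num h) \<longleftrightarrow> in_quadrant h (set qs) p"
proof
  assume h: "in_quadrant h (set qs) p"
  then have "in_quadrant h {hd qs} p"
    using assms by (auto intro: in_quadrant_mono)
  with h show "pin_step qs p (Num h)"
    using assms by (auto simp: pin_step_def pin_independent_iff)
qed (use assms pin_step_quadrant in blast)

lemma pin_run_append:
  assumes "length u = length ps"
  shows "pin_run qs (ps @ ps') (u @ v) \<longleftrightarrow> pin_run qs ps u \<and> pin_run (qs @ ps) ps' v"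
proof -
  let ?P = "\<lambda>i. pin_step (qs @ take i (ps @ ps')) ((ps @ ps') ! i) ((u @ v) ! i)"
  have "(\<forall>i<length ps + length ps'. ?P i) \<longleftrightarrow>
    (\<forall>i<length ps. ?P i) \<and> (\<forall>j<length ps'. ?P (length ps + j))"
  proof (intro iffI conjI allI impI)
    fix i
    assume P: "(\<forall>i<length ps. ?P i) \<and> (\<forall>j<length ps'. ?P (length ps + j))"
      and "i < length ps + length ps'"
    then show "?P i"
      using le_add_diff_inverse[of "length ps" i] by (metis add_less_cancel_left not_less)
  qed (simp_all only: trans_less_add1 add_less_cancel_left)
  then show ?thesis
    using assms by (auto simp: pin_run_def nth_append)
qed

text \<open>A point of \<open>S\<close> to the lower left of \<open>p\<close> rules out that
  \<open>p\<close> lies left of or below all of \<open>S\<close>. The remaining alternatives hold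
  for such points anyway, which is how they can be exchanged for others.\<close>

lemma separates_Q1:
  assumes "s \<in> S" "in_quadrant Q1 {s} p"
  shows "separates p q S \<longleftrightarrow> (fst p < fst q \<and> (\<forall>s\<in>S. fst s < fst p)) \<or>
    (snd p < snd q \<and> (\<forall>s\<in>S. snd s < snd p))"
proof -
  have "\<not> (\<forall>s\<in>S. fst p < fst s)" "\<not> (\<forall>s\<in>S. snd p < snd s)"
    using assms by (meson in_quadrant.simps(1) less_asym singletonI)+
  then show ?thesis
    unfolding separates_def by blast
qed

lemma separates_Q3:
  assumes "s \<in> S" "in_quadrant Q3 {s} p"
  shows "separates p q S \<longleftrightarrow> (fst q < fst p \<and> (\<forall>s\<in>S. fst p < fst s)) \<or>
    (snd q < snd p \<and> (\<forall>s\<in>S. snd p < snd s))"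
proof -
  have "\<not> (\<forall>s\<in>S. fst s < fst p)" "\<not> (\<forall>s\<in>S. snd s < snd p)"
    using assms by (meson in_quadrant.simps(3) less_asym singletonI)+
  then show ?thesis
    unfolding separates_def by blast
qed

text \<open>\<open>p\<close> lies in the same quadrant \<open>h\<close> of \<open>q0\<close> and of
  \<open>R\<close>, so these points compare alike with \<open>p\<close> on both axes and exchanging
  them changes no condition on \<open>p\<close>. An empty \<open>ts\<close> is special, since then
  the previous pin is exchanged too.\<close>

lemma pin_step_change_origin:
  assumes h: "h \<in> {Q1, Q3}" and R: "R \<noteq> []"
    and quad: "\<And>x. x \<in> insert p (set ts) \<Longrightarrow> in_quadrant h (insert q0 (set R)) x"
  shows "pin_step (q0 # ts) p l \<longleftrightarrow> pin_step (R @ ts) p l"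
proof (cases l)
  case (Num h')
  have "in_quadrant h' (set (q0 # ts)) p \<longleftrightarrow> in_quadrant h' (set (R @ ts)) p"
  proof (cases "h' = h")
    case True
    then show ?thesis
      using quad[of p] by (cases h) auto
  next
    case False
    have "in_quadrant h (insert q0 (set R)) p"
      using quad by simp
    then have "in_quadrant h {q0} p" "in_quadrant h (set R) p"
      by (auto intro: in_quadrant_mono)
    then have "\<not> in_quadrant h' {q0} p" "\<not> in_quadrant h' (set R) p"
      using False in_quadrant_unique R by (metis insert_not_empty, metis set_empty)
    then show ?thesis
      using in_quadrant_mono[of h' "set (q0 # ts)" p "{q0}"]
        in_quadrant_mono[of h' "set (R @ ts)" p "set R"] by auto
  qed
  then show ?thesis
    using R Num by (simp add: pin_step_Num_iff)
next
  case (Dir d)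
  obtain r where r: "r \<in> set R"
    using R by (meson ex_in_conv set_empty)
  show ?thesis
  proof (cases ts rule: rev_cases)
    \<comment> \<open>No direction is possible with either prefix: one point is too short a prefix,
      and \<open>p\<close> lies beyond all of \<open>R\<close> on both axes, so neither of its lines
      passes between \<open>last R\<close> and the rest of \<open>R\<close>.\<close>
    case Nil
    have "\<not> separates p (last R) (set (butlast R))" if "2 \<le> length R"
    proof -
      have "set (butlast R) \<noteq> {}"
        using that by (cases R rule: rev_cases; cases "butlast R") auto
      then obtain s where "s \<in> set (butlast R)"
        by (meson ex_in_conv)
      then have "s \<in> set R" "last R \<in> set R"
        using R by (auto dest: in_set_butlastD)
      then show ?thesis
        using quad[of p] h \<open>s \<in> set (butlast R)\<close> separates_Q1[of s _ p] separates_Q3[of s _ p]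
        by (cases h) auto
    qed
    then show ?thesis
      using Nil Dir by (auto simp: pin_step_def)
  next
    case (snoc ts' q)
    have p: "in_quadrant h (insert q0 (set R)) p"
      using quad snoc by auto
    have "separates p q (insert q0 (set ts')) \<longleftrightarrow> separates p q (set R \<union> set ts')"
    proof (cases "h = Q1")
      case True
      have "separates p q (insert q0 (set ts')) \<longleftrightarrow>
        (fst p < fst q \<and> (\<forall>s\<in>set ts'. fst s < fst p)) \<or> (snd p < snd q \<and> (\<forall>s\<in>set ts'. snd s < snd p))"
        using p True by (subst separates_Q1[of q0]) simp_all
      also have "\<dots> \<longleftrightarrow> separates p q (set R \<union> set ts')"
        using p True r by (subst separates_Q1[of r]) (simp_all add: ball_Un)
      finally show ?thesis .
    next
      case False
      then have "h = Q3" using h by simp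
      have "separates p q (insert q0 (set ts')) \<longleftrightarrow>
        (fst q < fst p \<and> (\<forall>s\<in>set ts'. fst p < fst s)) \<or> (snd q < snd p \<and> (\<forall>s\<in>set ts'. snd p < snd s))"
        using p \<open>h = Q3\<close> by (subst separates_Q3[of q0]) simp_all
      also have "\<dots> \<longleftrightarrow> separates p q (set R \<union> set ts')"
        using p \<open>h = Q3\<close> r by (subst separates_Q3[of r]) (simp_all add: ball_Un)
      finally show ?thesis .
    qed
    moreover have "in_direction d (insert q0 (set ts)) p \<longleftrightarrow> in_direction d (set R \<union> set ts) p"
    proof -
      have pr: "in_quadrant h {r} p"
        using p r by (auto intro: in_quadrant_mono)
      have "(fst q0 < fst p \<and> \<not> fst p < fst q0 \<and> (\<forall>s\<in>set R. fst s < fst p) \<and> \<not> fst p < fst r) \<or>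
        (\<not> fst q0 < fst p \<and> fst p < fst q0 \<and> (\<forall>s\<in>set R. fst p < fst s) \<and> \<not> fst r < fst p)"
        and "(snd q0 < snd p \<and> \<not> snd p < snd q0 \<and> (\<forall>s\<in>set R. snd s < snd p) \<and> \<not> snd p < snd r) \<or>
        (\<not> snd q0 < snd p \<and> snd p < snd q0 \<and> (\<forall>s\<in>set R. snd p < snd s) \<and> \<not> snd r < snd p)"
        using p pr h by (cases h; simp add: order.asym)+
      then show ?thesis
        using r by (cases d; simp only: in_direction.simps; blast)
    qed
    moreover have "2 \<le> length (R @ ts)"
      using R snoc by (cases R) auto
    ultimately show ?thesis
      using snoc Dir by (simp add: pin_step_def butlast_append)
  qed
qed

text \<open>Gives the tail of a run an origin of its own, and conversely lets a run continue an
  earlier one; it serves both inclusions of the recursion.\<close>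

lemma pin_run_change_origin:
  assumes "h \<in> {Q1, Q3}" "R \<noteq> []"
    and quad: "\<And>x. x \<in> set ps \<Longrightarrow> in_quadrant h (insert q0 (set R)) x"
  shows "pin_run [q0] ps w \<longleftrightarrow> pin_run R ps w"
proof -
  have "pin_step (q0 # take i ps) (ps ! i) (w ! i) \<longleftrightarrow> pin_step (R @ take i ps) (ps ! i) (w ! i)"
    if "i < length ps" for i
    using that by (intro pin_step_change_origin[OF assms(1,2)]) (auto intro!: quad dest: in_set_takeD)
  then show ?thesis
    by (simp add: pin_run_def)
qed

section \<open>Invariance under order embeddings\<close>

definition order_embedding_on :: "point set \<Rightarrow> (point \<Rightarrow> point) \<Rightarrow> bool" where
  "order_embedding_on A f \<longleftrightarrow> (\<forall>x\<in>A. \<forall>y\<in>A. (fst (f x) < fst (f y) \<longleftrightarrow> fst x < fst y) \<and>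
     (snd (f x) < snd (f y) \<longleftrightarrow> snd x < snd y))"

text \<open>Once independence is replaced by a quadrant condition, a step consists of strict
  comparisons of coordinates, which \<open>f\<close> preserves and reflects.\<close>

lemma pin_step_map:
  assumes "order_embedding_on (insert p (set qs)) f" "qs \<noteq> []"
  shows "pin_step (map f qs) (f p) l \<longleftrightarrow> pin_step qs p l"
proof (cases l)
  case (Num h)
  have "in_quadrant h (f ` set qs) (f p) \<longleftrightarrow> in_quadrant h (set qs) p"
    using assms(1) by (cases h) (auto simp: order_embedding_on_def)
  then show ?thesis
    using Num assms(2) by (simp add: pin_step_Num_iff)
next
  case (Dir d)
  have f: "fst (f x) < fst (f y) \<longleftrightarrow> fst x < fst y" "snd (f x) < snd (f y) \<longleftrightarrow> snd x < snd y"
    if "x \<in> insert p (set qs)" "y \<in> insert p (set qs)" for x y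
    using assms(1) that by (auto simp: order_embedding_on_def)
  have sub: "x \<in> insert p (set qs)" if "x \<in> set (butlast qs)" for x
    using that by (auto dest: in_set_butlastD)
  have "in_direction d (f ` set qs) (f p) \<longleftrightarrow> in_direction d (set qs) p"
    using f by (cases d) simp_all
  moreover have "separates (f p) (f (last qs)) (f ` set (butlast qs)) \<longleftrightarrow>
    separates p (last qs) (set (butlast qs))"
    unfolding separates_def using assms(2) sub by (simp add: f)
  ultimately show ?thesis
    using Dir assms(2) by (simp add: pin_step_def last_map map_butlast[symmetric])
qed

lemma order_embedding_on_subset:
  "order_embedding_on B f \<Longrightarrow> A \<subseteq> B \<Longrightarrow> order_embedding_on A f"
  unfolding order_embedding_on_def by blast

lemma pin_run_map:
  assumes "order_embedding_on (set (qs @ ps)) f" "qs \<noteq> []"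
  shows "pin_run (map f qs) (map f ps) w \<longleftrightarrow> pin_run qs ps w"
proof -
  have "pin_step (map f qs @ take i (map f ps)) (map f ps ! i) (w ! i) \<longleftrightarrow>
    pin_step (qs @ take i ps) (ps ! i) (w ! i)" if "i < length ps" for i
  proof -
    have "insert (ps ! i) (set (qs @ take i ps)) \<subseteq> set (qs @ ps)"
      using that by (auto dest: in_set_takeD)
    then show ?thesis
      using pin_step_map[of "ps ! i" "qs @ take i ps" f "w ! i"] assms(2) that
        order_embedding_on_subset[OF assms(1)] by (simp add: take_map)
  qed
  then show ?thesis
    by (simp add: pin_run_def)
qed

section \<open>Appending a block to a pin sequence\<close>

lemma finite_sets_gap:
  fixes A B :: "real set"
  assumes "finite A" "finite B" "\<And>a b. a \<in> A \<Longrightarrow> b \<in> B \<Longrightarrow> a < b"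
  shows "\<exists>c. (\<forall>a\<in>A. a < c) \<and> (\<forall>b\<in>B. c < b)"
proof -
  consider "A = {}" "B = {}" | "A \<noteq> {}" "B = {}" | "A = {}" "B \<noteq> {}" | "A \<noteq> {}" "B \<noteq> {}"
    by blast
  then show ?thesis
  proof cases
    case 2
    then show ?thesis
      using assms(1) gt_ex[of "Max A"] by auto
  next
    case 3
    then show ?thesis
      using assms(2) lt_ex[of "Min B"] by auto
  next
    case 4
    then have "Max A < Min B"
      using assms by simp
    then show ?thesis
      using assms 4 dense[of "Max A" "Min B"] by auto
  qed simp
qed

text \<open>Capping at \<open>c\<close> can alter the comparison only of two different values that
  are both at least \<open>c\<close>.\<close>

lemma min_less_min_iff:
  fixes x y c :: real
  shows "x = y \<or> x < c \<or> y < c \<Longrightarrow> min x c < min y c \<longleftrightarrow> x < y"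
  by (auto simp: min_def)

lemma max_less_max_iff:
  fixes x y c :: real
  shows "x = y \<or> c < x \<or> c < y \<Longrightarrow> max x c < max y c \<longleftrightarrow> x < y"
  by (auto simp: max_def)

text \<open>The given origin may lie anywhere, even beyond \<open>E\<close>. Cutting the coordinates
  off at values \<open>c\<close> and \<open>d\<close> between \<open>ps\<close> and \<open>E\<close>
  fixes \<open>ps\<close>, pulls the origin to the near side of \<open>E\<close> and keeps the order
  pattern.\<close>

lemma pin_run_move_origin:
  assumes run: "pin_run [p0] ps w" and h: "h \<in> {Q1, Q3}" and E: "finite E"
    and quad: "\<And>e. e \<in> E \<Longrightarrow> in_quadrant h (set ps) e"
  obtains p0' where "pin_run [p0'] ps w" "\<And>e. e \<in> E \<Longrightarrow> in_quadrant h (insert p0' (set ps)) e"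
proof (cases "h = Q1")
  case True
  obtain c where c: "\<forall>x\<in>fst ` set ps. x < c" "\<forall>x\<in>fst ` E. c < x"
  proof (atomize_elim, rule finite_sets_gap)
    show "a < b" if "a \<in> fst ` set ps" "b \<in> fst ` E" for a b
      using quad True that by auto
  qed (use E in auto)
  obtain d where d: "\<forall>x\<in>snd ` set ps. x < d" "\<forall>x\<in>snd ` E. d < x"
  proof (atomize_elim, rule finite_sets_gap)
    show "a < b" if "a \<in> snd ` set ps" "b \<in> snd ` E" for a b
      using quad True that by auto
  qed (use E in auto)
  let ?f = "\<lambda>p. (min (fst p) c, min (snd p) d)"
  \<comment> \<open>Only \<open>p0\<close> can reach \<open>c\<close> or \<open>d\<close>, so no two
    different coordinates are merged.\<close>
  have "order_embedding_on (set ([p0] @ ps)) ?f"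
    using c d by (auto simp: order_embedding_on_def intro!: min_less_min_iff)
  then have "pin_run (map ?f [p0]) (map ?f ps) w"
    using run by (subst pin_run_map) auto
  moreover have "map ?f ps = ps"
    using c d by (intro map_idI) (auto simp: min_def prod_eq_iff)
  ultimately have "pin_run [?f p0] ps w"
    by simp
  moreover have "in_quadrant h (insert (?f p0) (set ps)) e" if "e \<in> E" for e
    using quad[OF that] c d that True by (auto simp: min_less_iff_disj)
  ultimately show ?thesis
    using that by blast
next
  case False
  then have h: "h = Q3" using h by simp
  obtain c where c: "\<forall>x\<in>fst ` E. x < c" "\<forall>x\<in>fst ` set ps. c < x"
  proof (atomize_elim, rule finite_sets_gap)
    show "a < b" if "a \<in> fst ` E" "b \<in> fst ` set ps" for a b
      using quad h that by auto
  qed (use E in auto)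
  obtain d where d: "\<forall>x\<in>snd ` E. x < d" "\<forall>x\<in>snd ` set ps. d < x"
  proof (atomize_elim, rule finite_sets_gap)
    show "a < b" if "a \<in> snd ` E" "b \<in> snd ` set ps" for a b
      using quad h that by auto
  qed (use E in auto)
  let ?f = "\<lambda>p. (max (fst p) c, max (snd p) d)"
  have "order_embedding_on (set ([p0] @ ps)) ?f"
    using c d by (auto simp: order_embedding_on_def intro!: max_less_max_iff)
  then have "pin_run (map ?f [p0]) (map ?f ps) w"
    using run by (subst pin_run_map) auto
  moreover have "map ?f ps = ps"
    using c d by (intro map_idI) (auto simp: max_def prod_eq_iff)
  ultimately have "pin_run [?f p0] ps w"
    by simp
  moreover have "in_quadrant h (insert (?f p0) (set ps)) e" if "e \<in> E" for e
    using quad[OF that] c d that h by (auto simp: less_max_iff_disj)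
  ultimately show ?thesis
    using that by blast
qed

text \<open>Read \<open>D\<close> first, with its origin moved away from \<open>E\<close>. Then
  \<open>E\<close> lies in quadrant \<open>h\<close> of everything read, and the whole first run can
  replace the origin \<open>q0\<close> of the second.\<close>

lemma set_words_conc_subset:
  assumes h: "h \<in> {Q1, Q3}" and quad: "\<And>e. e \<in> E \<Longrightarrow> in_quadrant h D e"
  shows "set_words D \<cdot> set_words_from h E \<subseteq> set_words (D \<union> E)"
proof
  fix w assume "w \<in> set_words D \<cdot> set_words_from h E"
  then obtain u v p0 q0 ps qs where w: "w = u @ v" and D: "set ps = D" and u: "pin_run [p0] ps u"
    and E: "set qs = E" and v: "pin_run [q0] qs v" and q0: "\<forall>e\<in>E. in_quadrant h {q0} e"
    unfolding conc_def set_words_def set_words_from_def by blast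
  obtain p0' where p0': "pin_run [p0'] ps u"
    and quad': "\<And>e. e \<in> E \<Longrightarrow> in_quadrant h (insert p0' (set ps)) e"
    using pin_run_move_origin[OF u h, of E] quad D E by (metis List.finite_set)
  have "in_quadrant h (insert q0 (set ([p0'] @ ps))) e" if "e \<in> set qs" for e
    using quad'[of e] q0 that E h by auto
  then have "pin_run ([p0'] @ ps) qs v"
    using v pin_run_change_origin[OF h, of "[p0'] @ ps" qs q0 v] by simp
  then have "pin_run [p0'] (ps @ qs) w"
    using p0' unfolding w by (subst pin_run_append) (auto simp: pin_run_def)
  then show "w \<in> set_words (D \<union> E)"
    using D E unfolding set_words_def
    by (intro CollectI exI[of _ p0'] exI[of _ "ps @ qs"]) simp
qed

section \<open>Invariance under translations\<close>

definition translate :: "real \<Rightarrow> point \<Rightarrow> point" where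
  "translate c p = (fst p + c, snd p + c)"

lemma translate_translate [simp]: "translate c (translate d p) = translate (c + d) p"
  and translate_0 [simp]: "translate 0 p = p"
  by (simp_all add: translate_def)

lemma in_quadrant_translate [simp]:
  "in_quadrant h (translate c ` S) (translate c p) \<longleftrightarrow> in_quadrant h S p"
  by (cases h) (auto simp: translate_def)

lemma pin_run_translate [simp]:
  "qs \<noteq> [] \<Longrightarrow> pin_run (map (translate c) qs) (map (translate c) ps) w \<longleftrightarrow> pin_run qs ps w"
  by (rule pin_run_map) (auto simp: order_embedding_on_def translate_def)

lemma set_words_translate [simp]: "set_words (translate c ` D) = set_words D"
proof -
  have "set_words D \<subseteq> set_words (translate c ` D)" for c D
  proof
    fix w assume "w \<in> set_words D"
    then obtain p0 ps where "set ps = D" "pin_run [p0] ps w"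
      by (auto simp: set_words_def)
    then have "set (map (translate c) ps) = translate c ` D"
      "pin_run [translate c p0] (map (translate c) ps) w"
      using pin_run_translate[of "[p0]" c ps w] by auto
    then show "w \<in> set_words (translate c ` D)"
      unfolding set_words_def by blast
  qed
  from this[of D c] this[of "translate c ` D" "- c"] show ?thesis
    by (simp add: image_image)
qed

lemma set_words_from_translate [simp]: "set_words_from h (translate c ` D) = set_words_from h D"
proof -
  have "set_words_from h D \<subseteq> set_words_from h (translate c ` D)" for c D
  proof
    fix w assume "w \<in> set_words_from h D"
    then obtain p0 ps where "\<forall>p\<in>D. in_quadrant h {p0} p" "set ps = D" "pin_run [p0] ps w"
      by (auto simp: set_words_from_def)
    then have "set (map (translate c) ps) = translate c ` D"
      "\<forall>p\<in>translate c ` D. in_quadrant h {translate c p0} p"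
      "pin_run [translate c p0] (map (translate c) ps) w"
      using pin_run_translate[of "[p0]" c ps w] in_quadrant_translate[of h c "{p0}"] by auto
    then show "w \<in> set_words_from h (translate c ` D)"
      unfolding set_words_from_def by blast
  qed
  from this[of D c] this[of "translate c ` D" "- c"] show ?thesis
    by (simp add: image_image)
qed

section \<open>Splitting off the last block\<close>

abbreviation precedes :: "point \<Rightarrow> point \<Rightarrow> bool" (infix "\<prec>" 50) where
  "p \<prec> q \<equiv> fst p < fst q \<and> snd p < snd q"

text \<open>Overlapping \<open>X\<close> and \<open>Y\<close> are harmless, since no point precedes
  itself. The empty set qualifies, which lets the condition range over all values of a block
  numbering.\<close>

definition sum_indecomposable :: "point set \<Rightarrow> bool" where
  "sum_indecomposable D \<longleftrightarrow>
     (\<forall>X Y. X \<noteq> {} \<and> Y \<noteq> {} \<and> X \<union> Y = D \<longrightarrow> (\<exists>x\<in>X. \<exists>y\<in>Y. \<not> x \<prec> y))"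

text \<open>One coordinate of \<open>p\<close> lies strictly between those of \<open>q\<close> and
  \<open>s\<close>, so \<open>p\<close> cannot be on the same side of both.\<close>

lemma separates_between:
  assumes "separates p q S" "s \<in> S"
  shows "\<not> (p \<prec> q \<and> p \<prec> s)" "\<not> (q \<prec> p \<and> s \<prec> p)"
  using assms unfolding separates_def by (meson less_asym)+

lemma not_bbox_between:
  assumes "p \<notin> bbox S" "finite S" "x \<in> S" "y \<in> S"
  shows "\<not> (x \<prec> p \<and> p \<prec> y)"
proof
  assume "x \<prec> p \<and> p \<prec> y"
  then have "(\<exists>s\<in>S. fst s \<le> fst p) \<and> (\<exists>s\<in>S. fst p \<le> fst s) \<and>
    (\<exists>s\<in>S. snd s \<le> snd p) \<and> (\<exists>s\<in>S. snd p \<le> snd s)"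
    using assms(3,4) by (meson less_imp_le)
  moreover have "S \<noteq> {}"
    using assms(3) by auto
  ultimately show False
    using assms mem_bbox by blast
qed

text \<open>The function \<open>b\<close> numbers the blocks from the lower left to the upper right.\<close>

lemma set_words_split:
  fixes b :: "point \<Rightarrow> nat"
  assumes w: "w \<in> set_words D"
    and prec: "\<And>p q. p \<in> D \<Longrightarrow> q \<in> D \<Longrightarrow> b p < b q \<Longrightarrow> p \<prec> q"
    and indec: "\<And>t. sum_indecomposable {p \<in> D. b p = t}"
    and card: "3 \<le> card (b ` D)"
  obtains h t where "t \<in> b ` D"
    "(h = Q1 \<and> (\<forall>p\<in>D. b p \<le> t)) \<or> (h = Q3 \<and> (\<forall>p\<in>D. t \<le> b p))"
    "w \<in> set_words (D - {p \<in> D. b p = t}) \<cdot> set_words_from h {p \<in> D. b p = t}"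
proof -
  obtain p0 ps where D: "set ps = D" and run: "pin_run [p0] ps w"
    using w by (auto simp: set_words_def)
  define n where "n = length ps"
  define S where "S i = insert p0 (set (take i ps))" for i
  have finS: "finite (S i)" for i
    by (simp add: S_def)
  have dist: "distinct ps"
    using pin_run_distinct[OF run] by simp
  have inD: "ps ! i \<in> D" if "i < n" for i
    using that D n_def by auto
  have inS: "ps ! j \<in> S i" if "j < i" "j < n" for i j
    using that by (auto simp: S_def in_set_conv_nth n_def)
  have memS: "\<exists>j<i. j < n \<and> p = ps ! j" if "p \<in> set (take i ps)" for p i
    using that by (auto simp: in_set_conv_nth n_def)
  have inTake: "ps ! j \<in> set (take i ps)" if "j < i" "j < n" for i j
    using that unfolding n_def by (metis length_take min_less_iff_conj nth_mem nth_take)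
  have D_nth: "D = (!) ps ` {..<n}"
    unfolding D[symmetric] set_conv_nth n_def by blast
  have step: "pin_step (p0 # take i ps) (ps ! i) (w ! i)" if "i < n" for i
    using run that by (simp add: pin_run_def n_def)
  have out: "\<not> (x \<prec> ps ! i \<and> ps ! i \<prec> y)" if "i < n" "x \<in> S i" "y \<in> S i" for i x y
    using pin_step_not_bbox[OF step[OF that(1)]] that finS
    by (intro not_bbox_between[of _ "S i"]) (simp_all add: S_def)
  have between: "\<not> (ps ! i \<prec> ps ! (i - 1) \<and> ps ! i \<prec> s)" "\<not> (ps ! (i - 1) \<prec> ps ! i \<and> s \<prec> ps ! i)"
    if i: "i < n" "w ! i = Dir d" and s: "s \<in> S (i - 1)" for i d s
  proof -
    have i1: "1 \<le> i" and "separates (ps ! i) (last (p0 # take i ps)) (set (butlast (p0 # take i ps)))"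
      using step[OF i(1)] i(2) by (auto simp: pin_step_def)
    moreover have "last (p0 # take i ps) = ps ! (i - 1)"
      using i1 i(1) by (cases "ps = []") (auto simp: last_conv_nth n_def)
    moreover have "set (butlast (p0 # take i ps)) = S (i - 1)"
      using i1 i(1) by (cases "ps = []") (auto simp: S_def butlast_take n_def)
    ultimately have "separates (ps ! i) (ps ! (i - 1)) (S (i - 1))"
      by simp
    from separates_between[OF this s]
    show "\<not> (ps ! i \<prec> ps ! (i - 1) \<and> ps ! i \<prec> s)" "\<not> (ps ! (i - 1) \<prec> ps ! i \<and> s \<prec> ps ! i)"
      by auto
  qed
  have quad: "\<exists>h. in_quadrant h (S k) (ps ! i)"
    if k: "k \<le> i" "i < n" "w ! k = Num g" for i k g
  proof (cases "i = k")
    case True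
    then show ?thesis
      using pin_step_quadrant[of "p0 # take k ps" "ps ! k" g] step[of k] that
      by (auto simp: S_def)
  next
    case False
    \<comment> \<open>Since \<open>k < i\<close>, the prefix without its last point still contains
      \<open>S k\<close>, and any pin avoids both strips of that shorter prefix.\<close>
    then have "k \<le> i - 1" "take i ps \<noteq> []"
      using that by (auto simp: n_def)
    then have "S k \<subseteq> set (butlast (p0 # take i ps))"
      using set_take_subset_set_take[of k "i - 1" ps] that by (auto simp: S_def butlast_take n_def)
    moreover obtain h where "in_quadrant h (set (butlast (p0 # take i ps))) (ps ! i)"
      using pin_step_quadrant_butlast[OF step[OF k(2)]] by auto
    ultimately show ?thesis
      using in_quadrant_mono by blast
  qed
  have quad13: "\<exists>h\<in>{Q1, Q3}. in_quadrant h (S k) (ps ! i)"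
    if k: "k \<le> i" "i < n" "w ! k = Num g" and xy: "x \<in> set (take k ps)" "y \<in> set (take k ps)" "b x < b y"
    for i k g x y
  proof -
    obtain h where h: "in_quadrant h (S k) (ps ! i)"
      using quad[OF k] ..
    have xy': "x \<in> S k" "y \<in> S k" "x \<in> D" "y \<in> D"
      using xy D by (auto simp: S_def dest: in_set_takeD)
    have "\<not> b (ps ! i) < b y \<Longrightarrow> x \<prec> ps ! i" "\<not> b x < b (ps ! i) \<Longrightarrow> ps ! i \<prec> y"
      "b (ps ! i) < b y \<Longrightarrow> ps ! i \<prec> y" "b x < b (ps ! i) \<Longrightarrow> x \<prec> ps ! i"
      using prec xy xy' inD[OF k(2)] by auto
    \<comment> \<open>Wherever the block of \<open>ps ! i\<close> lies, it comes after that of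
      \<open>x\<close> or before that of \<open>y\<close>; either relation excludes quadrants 2 and
      4.\<close>
    then have "(x \<prec> ps ! i) \<or> (ps ! i \<prec> y)"
      by blast
    moreover have "h = Q1 \<or> h = Q3" if "x \<prec> ps ! i \<or> ps ! i \<prec> y"
    proof -
      have "in_quadrant h {x} (ps ! i)" "in_quadrant h {y} (ps ! i)"
        using h xy' by (auto intro: in_quadrant_mono)
      then show ?thesis
        using that by (cases h) auto
    qed
    ultimately show ?thesis
      using h by blast
  qed
  \<comment> \<open>Otherwise the read and the unread part of the block of \<open>p\<close> would be a sum decomposition of it.\<close>
  have closed: "b (ps ! i) \<noteq> b p"
    if k: "k \<le> i" "i < n" "w ! k = Num g" and xy: "x \<in> set (take k ps)" "y \<in> set (take k ps)" "b x < b y"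
      and p: "p \<in> set (take k ps)" for i k g x y p
  proof
    assume eq: "b (ps ! i) = b p"
    define X where "X = {q \<in> set (take k ps). b q = b p}"
    define Y where "Y = {q \<in> D. b q = b p} - set (take k ps)"
    have "ps ! i \<notin> set (take k ps)"
      using memS[of "ps ! i" k] dist k by (auto simp: n_def nth_eq_iff_index_eq)
    then have "p \<in> X" "ps ! i \<in> Y"
      using p eq inD[OF k(2)] by (simp_all add: X_def Y_def)
    then have ne: "X \<noteq> {}" "Y \<noteq> {}"
      by auto
    have un: "X \<union> Y = {q \<in> D. b q = b p}" "Y \<union> X = {q \<in> D. b q = b p}"
      using D by (auto simp: X_def Y_def dest: in_set_takeD)
    have cut: "\<exists>x\<in>A. \<exists>y\<in>B. \<not> x \<prec> y" if "A \<noteq> {}" "B \<noteq> {}" "A \<union> B = {q \<in> D. b q = b p}" for A B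
      using indec[of "b p"] that unfolding sum_indecomposable_def by blast
    \<comment> \<open>Both orders of the two parts are needed: the first pair refutes quadrant 1 for
      \<open>v\<close>, the second quadrant 3 for \<open>v'\<close>.\<close>
    obtain u v u' v' where uv: "u \<in> X" "v \<in> Y" "\<not> u \<prec> v" "u' \<in> X" "v' \<in> Y" "\<not> v' \<prec> u'"
      using cut[OF ne un(1)] cut[OF ne(2,1) un(2)] by blast
    have Y: "\<exists>h\<in>{Q1, Q3}. in_quadrant h (S k) q" if q: "q \<in> Y" for q
    proof -
      have "q \<in> (!) ps ` {..<n}"
        using q by (simp add: Y_def D_nth)
      then obtain j where "j < n" "q = ps ! j"
        by blast
      moreover have "k \<le> j"
        using q calculation inTake[of j k] unfolding Y_def by (metis DiffE not_le)
      ultimately show ?thesis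
        using quad13[OF _ _ k(3) xy] by blast
    qed
    \<comment> \<open>A read point of another block; \<open>x\<close> or \<open>y\<close> qualifies.
      Whether its block comes before or after that of \<open>p\<close> decides between the two
      quadrants.\<close>
    obtain z where z: "z \<in> set (take k ps)" "b z \<noteq> b p"
      using xy by (metis less_irrefl)
    have XS: "u \<in> S k" "u' \<in> S k" "z \<in> S k" "z \<in> D"
      using uv z D by (auto simp: X_def S_def dest: in_set_takeD)
    have YD: "b v = b p" "b v' = b p" "v \<in> D" "v' \<in> D"
      using uv by (auto simp: Y_def)
    show False
    proof (cases "b z < b p")
      case True
      then have "z \<prec> v"
        using prec XS YD by simp
      moreover obtain h where h: "h \<in> {Q1, Q3}" "in_quadrant h (S k) v"
        using Y[OF uv(2)] by blast
      moreover have "in_quadrant h {z} v"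
        using in_quadrant_mono[OF h(2)] XS(3) by simp
      ultimately have "in_quadrant Q1 (S k) v"
        by (cases h) auto
      then show False
        using uv XS by simp
    next
      case False
      then have "v' \<prec> z"
        using prec XS YD z by simp
      moreover obtain h where h: "h \<in> {Q1, Q3}" "in_quadrant h (S k) v'"
        using Y[OF uv(5)] by blast
      moreover have "in_quadrant h {z} v'"
        using in_quadrant_mono[OF h(2)] XS(3) by simp
      ultimately have "in_quadrant Q3 (S k) v'"
        by (cases h) auto
      then show False
        using uv XS by simp
    qed
  qed
  have n: "0 < n"
    using card D by (cases ps) (auto simp: n_def)
  have "\<exists>m<n. b (ps ! m) \<noteq> b (ps ! 0)"
  proof (rule ccontr)
    assume "\<not> ?thesis"
    then have "b ` D \<subseteq> {b (ps ! 0)}"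
      unfolding D_nth by (intro image_subsetI; simp only: singleton_iff) blast
    then have "card (b ` D) \<le> 1"
      using card_mono[of "{b (ps ! 0)}"] by simp
    with card show False by simp
  qed
  then obtain m where m: "m < n" "b (ps ! m) \<noteq> b (ps ! 0)"
    and m_least: "\<And>i. i < m \<Longrightarrow> i < n \<Longrightarrow> b (ps ! i) = b (ps ! 0)"
    using exists_least_iff[of "\<lambda>m. m < n \<and> b (ps ! m) \<noteq> b (ps ! 0)"] by blast
  have m0: "0 < m"
    using m by (cases m) auto
  \<comment> \<open>A pin separating two points of the first two blocks met lies in one of these blocks.\<close>
  have "\<exists>l g. m < l \<and> l < n \<and> w ! l = Num g"
  proof (rule ccontr)
    assume no: "\<not> ?thesis"
    have dir: "\<exists>d. w ! l = Dir d" if "m < l" "l < n" for l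
      using no that by (cases "w ! l") auto
    let ?lo = "min (b (ps ! 0)) (b (ps ! m))" and ?hi = "max (b (ps ! 0)) (b (ps ! m))"
    \<comment> \<open>The new pin separates \<open>ps ! l\<close> from earlier points, among them
      \<open>ps ! 0\<close>, so its block is neither below both of their blocks nor above
      both.\<close>
    have range: "?lo \<le> b (ps ! l) \<and> b (ps ! l) \<le> ?hi" if "m \<le> l" "l < n" for l
      using that
    proof (induction l rule: dec_induct)
      case (step l)
      obtain d where d: "w ! Suc l = Dir d"
        using dir[of "Suc l"] step by auto
      have "ps ! 0 \<in> S l"
        using step m0 by (intro inS) auto
      from between[OF \<open>Suc l < n\<close> d, of "ps ! 0"] this
      have "\<not> (ps ! Suc l \<prec> ps ! l \<and> ps ! Suc l \<prec> ps ! 0)"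
        "\<not> (ps ! l \<prec> ps ! Suc l \<and> ps ! 0 \<prec> ps ! Suc l)"
        by auto
      then have "\<not> (b (ps ! Suc l) < b (ps ! l) \<and> b (ps ! Suc l) < b (ps ! 0))"
        "\<not> (b (ps ! l) < b (ps ! Suc l) \<and> b (ps ! 0) < b (ps ! Suc l))"
        using prec inD[of l] inD[of "Suc l"] inD[of 0] step by (meson Suc_lessD n)+
      then show ?case
        using step by auto
    qed auto
    have "b (ps ! l) \<in> {b (ps ! 0), b (ps ! m)}" if "l < n" for l
    proof (cases "m < l")
      case True
      have "ps ! 0 \<in> S l" "ps ! m \<in> S l"
        using True that by (auto intro: inS)
      \<comment> \<open>A block strictly between the two would put the pin inside the bounding box
        of the points read so far.\<close>
      then have "\<not> (b (ps ! 0) < b (ps ! l) \<and> b (ps ! l) < b (ps ! m))"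
        "\<not> (b (ps ! m) < b (ps ! l) \<and> b (ps ! l) < b (ps ! 0))"
        using out[OF that, of "ps ! 0" "ps ! m"] out[OF that, of "ps ! m" "ps ! 0"]
          prec inD[OF that] inD[OF m(1)] inD[OF n] by blast+
      then show ?thesis
        using range[of l] True that by (auto simp: min_def max_def split: if_splits)
    next
      case False
      then show ?thesis
        using m_least[of l] that by (cases "l = m") auto
    qed
    then have "b ` D \<subseteq> {b (ps ! 0), b (ps ! m)}"
      unfolding D_nth image_image by (intro image_subsetI) simp
    then have "card (b ` D) \<le> card {b (ps ! 0), b (ps ! m)}"
      by (intro card_mono) auto
    also have "\<dots> \<le> 2"
      by (simp add: card_insert_if)
    finally show False
      using card by simp
  qed
  then obtain l gl where l: "m < l" "l < n" "w ! l = Num gl"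
    by blast
  define k where "k = (GREATEST k. k < n \<and> (\<exists>g. w ! k = Num g))"
  have "k < n \<and> (\<exists>g. w ! k = Num g)"
    unfolding k_def using l by (intro GreatestI_nat[of "\<lambda>k. k < n \<and> (\<exists>g. w ! k = Num g)" l n]) auto
  then obtain g where k: "k < n" "w ! k = Num g"
    by blast
  have k_greatest: "i \<le> k" if "i < n" "w ! i = Num g'" for i g'
    unfolding k_def using that by (intro Greatest_le_nat[of _ _ n]) auto
  \<comment> \<open>Hence two blocks have been met before \<open>k\<close>, as \<open>quad13\<close>
    and \<open>closed\<close> require.\<close>
  have mk: "m < k"
    using k_greatest[OF l(2,3)] l(1) by simp
  have ps0: "ps ! 0 \<in> set (take k ps)" "ps ! m \<in> set (take k ps)"
    using mk k m by (auto intro: inTake)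
  then obtain x y where xy: "x \<in> set (take k ps)" "y \<in> set (take k ps)" "b x < b y"
    using m(2) by (metis linorder_neqE_nat)
  obtain h where h: "h \<in> {Q1, Q3}" "in_quadrant h (S k) (ps ! k)"
    using quad13[OF order_refl k xy] by blast
  let ?t = "b (ps ! k)"
  have ps0': "ps ! 0 \<in> S k" "ps ! 0 \<in> D"
    using ps0 inD[OF n] by (auto simp: S_def)
  \<comment> \<open>Only separating pins follow \<open>k\<close>. Such a pin cannot jump over
    \<open>ps ! 0\<close> to the opposite quadrant. Separation keeps it from passing beyond block
    \<open>?t\<close>, and the bounding box containing \<open>ps ! 0\<close> and
    \<open>ps ! k\<close> keeps it from falling short of that block.\<close>
  have tail: "in_quadrant h (S k) (ps ! i) \<and> b (ps ! i) = ?t" if "k \<le> i" "i < n" for i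
    using that
  proof (induction i rule: dec_induct)
    case (step i)
    let ?p = "ps ! Suc i" and ?q = "ps ! i"
    have q: "in_quadrant h (S k) ?q" "b ?q = ?t"
      using step by auto
    obtain d where d: "w ! Suc i = Dir d"
      using k_greatest[of "Suc i"] step by (cases "w ! Suc i") auto
    obtain h' where h': "h' \<in> {Q1, Q3}" "in_quadrant h' (S k) ?p"
      using quad13[OF le_SucI[OF step(1)] step(4) k(2) xy] by blast
    have "S k \<subseteq> S i"
      using step set_take_subset_set_take[of k i ps] by (auto simp: S_def)
    then have "ps ! 0 \<in> S i" "ps ! 0 \<in> S (Suc i)"
      using ps0' inS[of 0 "Suc i"] n by auto
    then have btw: "\<not> (?p \<prec> ?q \<and> ?p \<prec> ps ! 0)" "\<not> (?q \<prec> ?p \<and> ps ! 0 \<prec> ?p)"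
      using between[OF \<open>Suc i < n\<close> d, of "ps ! 0"] by auto
    have "h' = h"
    proof (rule ccontr)
      assume "h' \<noteq> h"
      then consider "h = Q1" "h' = Q3" | "h = Q3" "h' = Q1"
        using h(1) h'(1) by auto
      then show False
      proof cases
        case 1
        then have "?p \<prec> ps ! 0" "ps ! 0 \<prec> ?q"
          using q(1) h'(2) ps0' by auto
        then show False
          using btw by (meson less_trans)
      next
        case 2
        then have "ps ! 0 \<prec> ?p" "?q \<prec> ps ! 0"
          using q(1) h'(2) ps0' by auto
        then show False
          using btw by (meson less_trans)
      qed
    qed
    have "ps ! k \<in> S (Suc i)"
      using step k by (intro inS) auto
    note out' = out[OF \<open>Suc i < n\<close> \<open>ps ! 0 \<in> S (Suc i)\<close> this] out[OF \<open>Suc i < n\<close> this \<open>ps ! 0 \<in> S (Suc i)\<close>]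
    have D': "?p \<in> D" "?q \<in> D" "ps ! k \<in> D"
      using inD step k by auto
    have "b ?p = ?t"
    proof (cases "h = Q1")
      case True
      then have a: "ps ! 0 \<prec> ?p" "ps ! 0 \<prec> ?q"
        using q(1) h'(2) ps0' \<open>h' = h\<close> by auto
      then have "\<not> ?t < b ?p"
        using btw(2) prec[of ?q ?p] D' q(2) by auto
      moreover have "\<not> b ?p < ?t"
        using out'(1) a prec[of ?p "ps ! k"] D' by auto
      ultimately show ?thesis by simp
    next
      case False
      then have "h = Q3" using h by simp
      then have a: "?p \<prec> ps ! 0" "?q \<prec> ps ! 0"
        using q(1) h'(2) ps0' \<open>h' = h\<close> by auto
      then have "\<not> b ?p < ?t"
        using btw(1) prec[of ?p ?q] D' q(2) by auto
      moreover have "\<not> ?t < b ?p"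
        using out'(2) a prec[of "ps ! k" ?p] D' by auto
      ultimately show ?thesis by simp
    qed
    then show ?case
      using h' \<open>h' = h\<close> by simp
  qed (use h in auto)
  let ?E = "{p \<in> D. b p = ?t}"
  \<comment> \<open>\<open>tail\<close> puts everything from \<open>k\<close> on into the block and
    \<open>closed\<close> keeps everything earlier out of it, so the cut at \<open>k\<close>
    isolates exactly one block.\<close>
  have drop: "set (drop k ps) = ?E" and take: "set (take k ps) = D - ?E"
  proof -
    have 1: "p \<in> ?E" if p: "p \<in> set (drop k ps)" for p
    proof -
      obtain i where "i < n - k" "p = ps ! (k + i)"
        using p k(1) unfolding n_def
        by (metis in_set_conv_nth length_drop less_imp_le nth_drop)
      then show ?thesis
        using tail[of "k + i"] inD[of "k + i"] by auto
    qed
    have 2: "p \<in> D - ?E" if "p \<in> set (take k ps)" for p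
      using closed[OF order_refl k xy that] that D by (auto dest: in_set_takeD)
    have "set (take k ps) \<union> set (drop k ps) = D"
      using D by (metis append_take_drop_id set_append)
    then show "set (drop k ps) = ?E" "set (take k ps) = D - ?E"
      using 1 2 by blast+
  qed
  have E: "in_quadrant h (S k) p" if p: "p \<in> ?E" for p
  proof -
    obtain i where "i < n - k" "p = ps ! (k + i)"
      using p k(1) unfolding drop[symmetric] n_def
      by (metis in_set_conv_nth length_drop less_imp_le nth_drop)
    then show ?thesis
      using tail[of "k + i"] by auto
  qed
  have "pin_run [p0] (take k ps @ drop k ps) (take k w @ drop k w)"
    using run by simp
  moreover have "length (take k w) = length (take k ps)"
    using run by (simp add: pin_run_def)
  ultimately have "pin_run [p0] (take k ps) (take k w)" "pin_run ([p0] @ take k ps) (drop k ps) (drop k w)"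
    using pin_run_append by blast+
  \<comment> \<open>The origin of the whole run also serves the block, which lies in quadrant
    \<open>h\<close> of \<open>S k\<close> and hence of \<open>p0\<close>.\<close>
  moreover have "pin_run [p0] (drop k ps) (drop k w) \<longleftrightarrow> pin_run ([p0] @ take k ps) (drop k ps) (drop k w)"
    using E by (intro pin_run_change_origin[OF h(1)]) (simp_all add: drop S_def)
  moreover have "\<forall>p\<in>?E. in_quadrant h {p0} p"
    using in_quadrant_mono[OF E] by (simp add: S_def)
  ultimately have "take k w \<in> set_words (D - ?E)" "drop k w \<in> set_words_from h ?E"
    unfolding set_words_def set_words_from_def using drop take by blast+
  then have w': "w \<in> set_words (D - ?E) \<cdot> set_words_from h ?E"
    unfolding conc_def by (metis (mono_tags, lifting) append_take_drop_id mem_Collect_eq)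
  \<comment> \<open>All points outside the block were read before \<open>k\<close>, so
    \<open>ps ! k\<close> lies in quadrant \<open>h\<close> of each of them, and its block is the
    last or the first.\<close>
  have "(h = Q1 \<and> (\<forall>p\<in>D. b p \<le> ?t)) \<or> (h = Q3 \<and> (\<forall>p\<in>D. ?t \<le> b p))"
  proof (cases "h = Q1")
    case True
    have "b p \<le> ?t" if "p \<in> D" for p
    proof (rule ccontr)
      assume "\<not> b p \<le> ?t"
      then have "p \<in> S k" "ps ! k \<prec> p"
        using take that prec inD[OF k(1)] by (auto simp: S_def)
      then show False
        using h(2) True by (auto dest: less_asym)
    qed
    with True show ?thesis by simp
  next
    case False
    then have "h = Q3" using h by simp
    have "?t \<le> b p" if "p \<in> D" for p
    proof (rule ccontr)
      assume "\<not> ?t \<le> b p"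
      then have "p \<in> S k" "p \<prec> ps ! k"
        using take that prec inD[OF k(1)] by (auto simp: S_def)
      then show False
        using h(2) \<open>h = Q3\<close> by (auto dest: less_asym)
    qed
    with \<open>h = Q3\<close> show ?thesis by simp
  qed
  then show ?thesis
    using that[of ?t h] w' inD[OF k(1)] by blast
qed

section \<open>Diagrams of direct sums\<close>

lemma is_perm_iff: "is_perm \<sigma> \<longleftrightarrow> distinct \<sigma> \<and> set \<sigma> = {1..length \<sigma>}"
  by (auto simp: is_perm_def permutations_of_set_def)

lemma diagram_image: "diagram \<sigma> = (\<lambda>i. (real (i + 1), real (\<sigma> ! i))) ` {..<length \<sigma>}"
  by (auto simp: diagram_def)

lemma diagram_bounds:
  assumes "is_perm \<sigma>" "p \<in> diagram \<sigma>"
  shows "1 \<le> fst p" "fst p \<le> length \<sigma>" "1 \<le> snd p" "snd p \<le> length \<sigma>"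
proof -
  obtain i where i: "i < length \<sigma>" "p = (real (i + 1), real (\<sigma> ! i))"
    using assms(2) by (auto simp: diagram_def)
  then have "\<sigma> ! i \<in> {1..length \<sigma>}"
    using assms(1) by (metis is_perm_iff nth_mem)
  then show "1 \<le> fst p" "fst p \<le> length \<sigma>" "1 \<le> snd p" "snd p \<le> length \<sigma>"
    using i by auto
qed

text \<open>The binary direct sum; being associative, it lets a block be split off at either
  end.\<close>

definition oplus :: "nat list \<Rightarrow> nat list \<Rightarrow> nat list" where
  "oplus \<sigma> \<tau> = \<sigma> @ map (\<lambda>v. v + length \<sigma>) \<tau>"

lemma length_oplus [simp]: "length (oplus \<sigma> \<tau>) = length \<sigma> + length \<tau>"
  by (simp add: oplus_def)

lemma oplus_Nil [simp]: "oplus [] \<tau> = \<tau>" "oplus \<sigma> [] = \<sigma>"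
  by (simp_all add: oplus_def)

lemma oplus_assoc: "oplus (oplus \<rho> \<sigma>) \<tau> = oplus \<rho> (oplus \<sigma> \<tau>)"
  by (simp add: oplus_def)

lemma diagram_oplus: "diagram (oplus \<sigma> \<tau>) = diagram \<sigma> \<union> translate (length \<sigma>) ` diagram \<tau>"
proof -
  let ?n = "length \<sigma>"
  have "{..<?n + length \<tau>} = {..<?n} \<union> (\<lambda>j. ?n + j) ` {..<length \<tau>}"
    by (rule set_eqI) (simp add: image_iff Bex_def; presburger)
  then show ?thesis
    by (auto simp: diagram_image image_Un image_image oplus_def nth_append translate_def intro!: image_cong)
qed

lemma is_perm_oplus:
  assumes "is_perm \<sigma>" "is_perm \<tau>"
  shows "is_perm (oplus \<sigma> \<tau>)"
proof -
  have "(\<lambda>v. v + length \<sigma>) ` {1..length \<tau>} = {length \<sigma> + 1..length \<sigma> + length \<tau>}"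
    by (subst image_add_atLeastAtMost') (simp add: add.commute)
  then show ?thesis
    using assms by (auto simp: is_perm_iff oplus_def distinct_map)
qed

text \<open>Coordinates in the diagram of \<sigma> are at most \<open>length \<sigma>\<close>; those
  in the shifted diagram of \<tau> exceed it by at least 1.\<close>

lemma diagram_oplus_precedes:
  assumes "is_perm \<sigma>" "is_perm \<tau>" "p \<in> diagram \<sigma>" "q \<in> translate (length \<sigma>) ` diagram \<tau>"
  shows "p \<prec> q"
proof -
  obtain q' where "q' \<in> diagram \<tau>" "q = translate (length \<sigma>) q'"
    using assms(4) by blast
  then show ?thesis
    using diagram_bounds[OF assms(1,3)] diagram_bounds[OF assms(2), of q'] by (auto simp: translate_def)
qed

lemma diagram_oplus_disjoint:
  assumes "is_perm \<sigma>" "is_perm \<tau>"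
  shows "diagram \<sigma> \<inter> translate (length \<sigma>) ` diagram \<tau> = {}"
  using diagram_oplus_precedes[OF assms] by (meson disjoint_iff less_irrefl)

text \<open>In the identity the smaller entries are those at earlier positions, so each block is
  shifted by the total length of its predecessors.\<close>

lemma direct_sum_concat:
  "direct_sum \<pi>s = concat (map (\<lambda>i. map (\<lambda>v. v + (\<Sum>j<i. length (\<pi>s ! j))) (\<pi>s ! i)) [0..<length \<pi>s])"
proof -
  have "{j. j < length \<pi>s \<and> [1..<length \<pi>s + 1] ! j < [1..<length \<pi>s + 1] ! i} = {..<i}"
    if "i < length \<pi>s" for i
    using that by (auto simp del: upt_Suc)
  then show ?thesis
    unfolding direct_sum_def inflate_def by (intro arg_cong[of _ _ concat] map_cong) (auto simp del: upt_Suc)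
qed

lemma direct_sum_Nil [simp]: "direct_sum [] = []"
  by (simp add: direct_sum_concat)

lemma direct_sum_snoc: "direct_sum (\<pi>s @ [\<beta>]) = oplus (direct_sum \<pi>s) \<beta>"
proof -
  have "length (direct_sum \<pi>s) = (\<Sum>j<length \<pi>s. length (\<pi>s ! j))"
    by (simp add: direct_sum_concat length_concat comp_def interv_sum_list_conv_sum_set_nat atLeast0LessThan)
  moreover have sums: "(\<Sum>j<i. length ((\<pi>s @ [\<beta>]) ! j)) = (\<Sum>j<i. length (\<pi>s ! j))" if "i \<le> length \<pi>s" for i
    using that by (intro sum.cong) (auto simp: nth_append)
  moreover have "map (\<lambda>i. map (\<lambda>v. v + (\<Sum>j<i. length ((\<pi>s @ [\<beta>]) ! j))) ((\<pi>s @ [\<beta>]) ! i)) [0..<length \<pi>s] =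
    map (\<lambda>i. map (\<lambda>v. v + (\<Sum>j<i. length (\<pi>s ! j))) (\<pi>s ! i)) [0..<length \<pi>s]"
    by (rule map_cong[OF refl]) (simp add: sums nth_append)
  moreover have "direct_sum (\<pi>s @ [\<beta>]) =
    concat (map (\<lambda>i. map (\<lambda>v. v + (\<Sum>j<i. length ((\<pi>s @ [\<beta>]) ! j))) ((\<pi>s @ [\<beta>]) ! i)) [0..<length \<pi>s]) @
    map (\<lambda>v. v + (\<Sum>j<length \<pi>s. length ((\<pi>s @ [\<beta>]) ! j))) \<beta>"
    by (simp add: direct_sum_concat)
  ultimately show ?thesis
    by (simp only: oplus_def sums[OF order_refl] direct_sum_concat[of \<pi>s, symmetric])
qed

lemma direct_sum_Cons: "direct_sum (\<alpha> # \<pi>s) = oplus \<alpha> (direct_sum \<pi>s)"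
proof (induction \<pi>s rule: rev_induct)
  case Nil
  then show ?case
    using direct_sum_snoc[of "[]" \<alpha>] by simp
next
  case (snoc \<beta> \<pi>s)
  then show ?case
    using direct_sum_snoc[of "\<alpha> # \<pi>s" \<beta>] by (simp add: direct_sum_snoc oplus_assoc)
qed

lemma is_perm_direct_sum: "(\<And>\<xi>. \<xi> \<in> set \<xi>s \<Longrightarrow> is_perm \<xi>) \<Longrightarrow> is_perm (direct_sum \<xi>s)"
  by (induction \<xi>s) (auto simp: direct_sum_Cons is_perm_oplus is_perm_iff[of "[]"])

lemma sum_indecomposable_translate:
  assumes "sum_indecomposable D"
  shows "sum_indecomposable (translate c ` D)"
  unfolding sum_indecomposable_def
proof (intro allI impI)
  fix X Y assume XY: "X \<noteq> {} \<and> Y \<noteq> {} \<and> X \<union> Y = translate c ` D"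
  then have "translate (- c) ` X \<union> translate (- c) ` Y = D"
    by (simp add: image_Un[symmetric] image_image)
  then have "\<exists>x\<in>translate (- c) ` X. \<exists>y\<in>translate (- c) ` Y. \<not> x \<prec> y"
    using XY by (intro assms[unfolded sum_indecomposable_def, rule_format]) simp
  then obtain x y where "x \<in> X" "y \<in> Y" "\<not> translate (- c) x \<prec> translate (- c) y"
    by blast
  then show "\<exists>x\<in>X. \<exists>y\<in>Y. \<not> x \<prec> y"
    by (intro bexI[of _ x] bexI[of _ y]) (auto simp: translate_def)
qed

text \<open>Collects what \<open>set_words_split\<close> asks of a numbering and identifies its
  lowest and highest classes, the ones that get split off.\<close>

definition block_function :: "nat list list \<Rightarrow> (point \<Rightarrow> nat) \<Rightarrow> bool" where
  "block_function \<xi>s b \<longleftrightarrow> b ` diagram (direct_sum \<xi>s) = {..<length \<xi>s} \<and>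
    (\<forall>p\<in>diagram (direct_sum \<xi>s). \<forall>q\<in>diagram (direct_sum \<xi>s). b p < b q \<longrightarrow> p \<prec> q) \<and>
    (\<forall>t. sum_indecomposable {p \<in> diagram (direct_sum \<xi>s). b p = t}) \<and>
    (\<xi>s \<noteq> [] \<longrightarrow> {p \<in> diagram (direct_sum \<xi>s). b p = 0} = diagram (hd \<xi>s) \<and>
      {p \<in> diagram (direct_sum \<xi>s). b p = length \<xi>s - 1} =
        translate (length (direct_sum (butlast \<xi>s))) ` diagram (last \<xi>s))"

text \<open>Blocks are appended on the right: earlier points keep their number, and the new upper
  right block gets the next one.\<close>

lemma ex_block_function:
  assumes "\<And>\<xi>. \<xi> \<in> set \<xi>s \<Longrightarrow> is_perm \<xi> \<and> \<xi> \<noteq> [] \<and> sum_indecomposable (diagram \<xi>)"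
  shows "\<exists>b. block_function \<xi>s b"
  using assms
proof (induction \<xi>s rule: rev_induct)
  case Nil
  show ?case
    by (auto simp: block_function_def diagram_def sum_indecomposable_def)
next
  case (snoc \<beta> \<xi>s)
  let ?D = "diagram (direct_sum \<xi>s)" and ?k = "length \<xi>s"
  define T where "T = translate (length (direct_sum \<xi>s)) ` diagram \<beta>"
  obtain b where "block_function \<xi>s b"
    using snoc by auto
  then have b: "b ` ?D = {..<?k}" "\<forall>p\<in>?D. \<forall>q\<in>?D. b p < b q \<longrightarrow> p \<prec> q"
    "\<forall>t. sum_indecomposable {p \<in> ?D. b p = t}" "\<xi>s \<noteq> [] \<Longrightarrow> {p \<in> ?D. b p = 0} = diagram (hd \<xi>s)"
    by (simp_all add: block_function_def)
  have \<beta>: "is_perm \<beta>" "\<beta> \<noteq> []" "sum_indecomposable (diagram \<beta>)" and perm: "is_perm (direct_sum \<xi>s)"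
    using snoc.prems is_perm_direct_sum by auto
  have D': "diagram (direct_sum (\<xi>s @ [\<beta>])) = ?D \<union> T"
    by (simp add: direct_sum_snoc diagram_oplus T_def)
  have DT: "p \<prec> q" if "p \<in> ?D" "q \<in> T" for p q
    using diagram_oplus_precedes[OF perm \<beta>(1)] that unfolding T_def by blast
  have disj: "?D \<inter> T = {}"
    using diagram_oplus_disjoint[OF perm \<beta>(1)] by (simp add: T_def)
  have T: "T \<noteq> {}" "sum_indecomposable T"
    using \<beta> sum_indecomposable_translate by (auto simp: T_def diagram_def)
  define b' where "b' p = (if p \<in> T then ?k else b p)" for p
  have bD: "b' p = b p" "b p < ?k" if "p \<in> ?D" for p
    using that disj b(1) by (auto simp: b'_def)
  have bT: "b' p = ?k" if "p \<in> T" for p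
    using that by (simp add: b'_def)
  have "b' ` (?D \<union> T) = b ` ?D \<union> {?k}"
    using T(1) bD bT by (auto simp: image_Un cong: image_cong)
  then have 1: "b' ` (?D \<union> T) = {..<length (\<xi>s @ [\<beta>])}"
    using b(1) by auto
  have 2: "p \<prec> q" if "p \<in> ?D \<union> T" "q \<in> ?D \<union> T" "b' p < b' q" for p q
  proof -
    have "p \<in> ?D"
      using that bT[of p] bD[of q] bT[of q] by force
    then show ?thesis
      using that b(2) bD DT by (metis UnE)
  qed
  have class_k: "{p \<in> ?D \<union> T. b' p = ?k} = T"
    using bD bT by force
  have class_other: "{p \<in> ?D \<union> T. b' p = t} = {p \<in> ?D. b p = t}" if "t \<noteq> ?k" for t
    using bD(1) bT that by force
  have 3: "sum_indecomposable {p \<in> ?D \<union> T. b' p = t}" for t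
    using class_k class_other[of t] T(2) b(3) by (cases "t = ?k") simp_all
  have 4: "{p \<in> ?D \<union> T. b' p = 0} = diagram (hd (\<xi>s @ [\<beta>]))"
  proof (cases "\<xi>s = []")
    case True
    then show ?thesis
      using class_k by (simp add: T_def)
  next
    case False
    then show ?thesis
      using class_other[of 0] b(4) by simp
  qed
  show ?case
    unfolding block_function_def D' using 1 2 3 4 class_k by (intro exI[of _ b']) (simp add: T_def)
qed

section \<open>Recursion for the pin words of a direct sum\<close>

lemma pin_words_oplus_supset:
  assumes "is_perm \<sigma>" "is_perm \<tau>"
  shows "pin_words \<sigma> \<cdot> pin_words_quadrant Q3 \<tau> \<subseteq> pin_words (oplus \<sigma> \<tau>)"
    and "pin_words \<tau> \<cdot> pin_words_quadrant Q1 \<sigma> \<subseteq> pin_words (oplus \<sigma> \<tau>)"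
proof -
  let ?T = "translate (length \<sigma>) ` diagram \<tau>"
  have dist: "distinct \<sigma>" "distinct \<tau>" "distinct (oplus \<sigma> \<tau>)"
    using assms is_perm_oplus[OF assms] by (simp_all add: is_perm_iff)
  have eq: "pin_words (oplus \<sigma> \<tau>) = set_words (diagram \<sigma> \<union> ?T)"
    using dist by (simp add: pin_words_eq diagram_oplus)
  have "set_words (diagram \<sigma>) \<cdot> set_words_from Q1 ?T \<subseteq> set_words (diagram \<sigma> \<union> ?T)"
    using diagram_oplus_precedes[OF assms] by (intro set_words_conc_subset) simp_all
  then show "pin_words \<sigma> \<cdot> pin_words_quadrant Q3 \<tau> \<subseteq> pin_words (oplus \<sigma> \<tau>)"
    using dist by (simp add: eq pin_words_eq pin_words_quadrant_Q3)
  have "set_words ?T \<cdot> set_words_from Q3 (diagram \<sigma>) \<subseteq> set_words (?T \<union> diagram \<sigma>)"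
    using diagram_oplus_precedes[OF assms] by (intro set_words_conc_subset) simp_all
  then show "pin_words \<tau> \<cdot> pin_words_quadrant Q1 \<sigma> \<subseteq> pin_words (oplus \<sigma> \<tau>)"
    using dist by (simp add: eq pin_words_eq pin_words_quadrant_Q1 Un_commute)
qed

text \<open>Three blocks provide the three values of \<open>b\<close> that
  \<open>set_words_split\<close> asks for. The level it returns is maximal with \<open>Q1\<close> or
  minimal with \<open>Q3\<close>. As \<open>h\<close> is the quadrant of the points seen from the
  origin, the last block comes with \<open>pin_words_quadrant Q3\<close> and the first with
  \<open>pin_words_quadrant Q1\<close>.\<close>

lemma pin_words_direct_sum_step:
  assumes \<xi>s: "\<And>\<xi>. \<xi> \<in> set \<xi>s \<Longrightarrow> is_perm \<xi> \<and> \<xi> \<noteq> [] \<and> sum_indecomposable (diagram \<xi>)"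
    and len: "3 \<le> length \<xi>s"
  shows "pin_words (direct_sum \<xi>s) =
    pin_words (direct_sum (tl \<xi>s)) \<cdot> pin_words_quadrant Q1 (hd \<xi>s) \<union>
    pin_words (direct_sum (butlast \<xi>s)) \<cdot> pin_words_quadrant Q3 (last \<xi>s)"
proof -
  have ne: "\<xi>s \<noteq> []"
    using len by auto
  define \<alpha> \<beta> \<sigma> \<tau> where "\<alpha> = hd \<xi>s" and "\<beta> = last \<xi>s" and "\<sigma> = direct_sum (butlast \<xi>s)"
    and "\<tau> = direct_sum (tl \<xi>s)"
  have ds: "direct_sum \<xi>s = oplus \<alpha> \<tau>" "direct_sum \<xi>s = oplus \<sigma> \<beta>"
    unfolding \<alpha>_def \<tau>_def \<beta>_def \<sigma>_def
    by (simp_all add: ne direct_sum_Cons[symmetric] direct_sum_snoc[symmetric])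
  have perm: "is_perm \<alpha>" "is_perm \<beta>" "is_perm \<sigma>" "is_perm \<tau>" "is_perm (direct_sum \<xi>s)"
    unfolding \<alpha>_def \<tau>_def \<beta>_def \<sigma>_def
    using \<xi>s ne by (auto intro!: is_perm_direct_sum dest: in_set_butlastD list.set_sel(2)[rotated])
  then have dist: "distinct \<alpha>" "distinct \<beta>" "distinct \<sigma>" "distinct \<tau>" "distinct (direct_sum \<xi>s)"
    by (simp_all add: is_perm_iff)
  let ?D = "diagram (direct_sum \<xi>s)"
  obtain b where "block_function \<xi>s b"
    using ex_block_function \<xi>s by blast
  then have b: "b ` ?D = {..<length \<xi>s}" "\<forall>p\<in>?D. \<forall>q\<in>?D. b p < b q \<longrightarrow> p \<prec> q"
    "\<forall>t. sum_indecomposable {p \<in> ?D. b p = t}" "{p \<in> ?D. b p = 0} = diagram \<alpha>"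
    "{p \<in> ?D. b p = length \<xi>s - 1} = translate (length \<sigma>) ` diagram \<beta>"
    using ne unfolding block_function_def \<alpha>_def \<beta>_def \<sigma>_def by simp_all
  have "pin_words (direct_sum \<xi>s) \<subseteq> pin_words \<tau> \<cdot> pin_words_quadrant Q1 \<alpha> \<union> pin_words \<sigma> \<cdot> pin_words_quadrant Q3 \<beta>"
  proof
    fix w assume "w \<in> pin_words (direct_sum \<xi>s)"
    then have wD: "w \<in> set_words ?D"
      using dist by (simp add: pin_words_eq)
    have prec: "p \<prec> q" if "p \<in> ?D" "q \<in> ?D" "b p < b q" for p q
      using b(2) that by blast
    have card: "3 \<le> card (b ` ?D)"
      using len by (simp add: b(1))
    obtain h t where t: "t \<in> b ` ?D"
      "(h = Q1 \<and> (\<forall>p\<in>?D. b p \<le> t)) \<or> (h = Q3 \<and> (\<forall>p\<in>?D. t \<le> b p))"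
      and w: "w \<in> set_words (?D - {p \<in> ?D. b p = t}) \<cdot> set_words_from h {p \<in> ?D. b p = t}"
      by (rule set_words_split[OF wD prec b(3)[rule_format] card])
    from t(2) show "w \<in> pin_words \<tau> \<cdot> pin_words_quadrant Q1 \<alpha> \<union> pin_words \<sigma> \<cdot> pin_words_quadrant Q3 \<beta>"
    proof (elim disjE conjE)
      assume h: "h = Q1" and max: "\<forall>p\<in>?D. b p \<le> t"
      have "length \<xi>s - 1 \<in> b ` ?D"
        using len by (simp add: b(1))
      then have "length \<xi>s - 1 \<le> t"
        using max by (metis imageE)
      moreover have "t < length \<xi>s"
        using t(1) by (simp add: b(1))
      ultimately have "t = length \<xi>s - 1"
        by simp
      moreover have "?D - translate (length \<sigma>) ` diagram \<beta> = diagram \<sigma>"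
        using diagram_oplus_disjoint[OF perm(3,2)] by (auto simp: ds(2) diagram_oplus)
      ultimately show ?thesis
        using w h dist b(5) by (simp add: pin_words_eq pin_words_quadrant_Q3)
    next
      assume h: "h = Q3" and min: "\<forall>p\<in>?D. t \<le> b p"
      have "0 \<in> b ` ?D"
        using ne by (simp add: b(1))
      then have "t = 0"
        using min by fastforce
      moreover have "?D - diagram \<alpha> = translate (length \<alpha>) ` diagram \<tau>"
        using diagram_oplus_disjoint[OF perm(1,4)] by (auto simp: ds(1) diagram_oplus)
      ultimately show ?thesis
        using w h dist b(4) by (simp add: pin_words_eq pin_words_quadrant_Q1)
    qed
  qed
  moreover have "pin_words \<tau> \<cdot> pin_words_quadrant Q1 \<alpha> \<subseteq> pin_words (direct_sum \<xi>s)"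
    "pin_words \<sigma> \<cdot> pin_words_quadrant Q3 \<beta> \<subseteq> pin_words (direct_sum \<xi>s)"
    using pin_words_oplus_supset perm ds by metis+
  ultimately show ?thesis
    unfolding \<alpha>_def \<tau>_def \<beta>_def \<sigma>_def by blast
qed

section \<open>Increasing oscillations are sum-indecomposable\<close>

text \<open>If all of \<open>X\<close> precedes all of \<open>Y\<close>, then \<open>X\<close> fills
  the positions before a cut and \<open>Y\<close> those from the cut on, the cut being the first
  position in \<open>Y\<close>. The assumed non-increasing pair across that cut is a
  contradiction.\<close>

lemma sum_indecomposable_diagram:
  assumes "\<And>m. 0 < m \<Longrightarrow> m < length \<sigma> \<Longrightarrow> \<exists>i<m. \<exists>j\<ge>m. j < length \<sigma> \<and> \<sigma> ! j \<le> \<sigma> ! i"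
  shows "sum_indecomposable (diagram \<sigma>)"
  unfolding sum_indecomposable_def
proof (intro allI impI)
  fix X Y assume XY: "X \<noteq> {} \<and> Y \<noteq> {} \<and> X \<union> Y = diagram \<sigma>"
  show "\<exists>x\<in>X. \<exists>y\<in>Y. \<not> x \<prec> y"
  proof (rule ccontr)
    assume "\<not> ?thesis"
    then have prec: "x \<prec> y" if "x \<in> X" "y \<in> Y" for x y
      using that by blast
    define pt where "pt i = (real (i + 1), real (\<sigma> ! i))" for i
    have diag: "X \<union> Y = pt ` {..<length \<sigma>}"
      using XY by (simp add: diagram_image pt_def)
    have pt: "i < j" "\<sigma> ! i < \<sigma> ! j" if "pt i \<in> X" "pt j \<in> Y" for i j
      using prec[OF that] by (simp_all add: pt_def)
    obtain x0 y0 where "x0 \<in> X" "y0 \<in> Y"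
      using XY by (meson ex_in_conv)
    then have "x0 \<in> pt ` {..<length \<sigma>}" "y0 \<in> pt ` {..<length \<sigma>}"
      using diag by (metis UnI1 UnI2)+
    then obtain i0 k0 where "pt i0 \<in> X" and "k0 < length \<sigma> \<and> pt k0 \<in> Y"
      using \<open>x0 \<in> X\<close> \<open>y0 \<in> Y\<close> by (metis imageE lessThan_iff)
    then have "\<exists>i. i < length \<sigma> \<and> pt i \<in> Y"
      by blast
    then obtain m where m: "m < length \<sigma>" "pt m \<in> Y"
      and least: "\<And>i. i < m \<Longrightarrow> \<not> (i < length \<sigma> \<and> pt i \<in> Y)"
      using exists_least_iff[of "\<lambda>i. i < length \<sigma> \<and> pt i \<in> Y"] by blast
    have "0 < m"
      using pt(1)[OF \<open>pt i0 \<in> X\<close> m(2)] by simp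
    then obtain i j where ij: "i < m" "m \<le> j" "j < length \<sigma>" "\<sigma> ! j \<le> \<sigma> ! i"
      using assms m by blast
    have "pt i \<in> X"
      using least[OF ij(1)] ij m diag by fastforce
    moreover have "pt j \<in> Y"
      using pt(1)[OF _ m(2), of j] ij diag by fastforce
    ultimately show False
      using pt(2) ij(4) by fastforce
  qed
qed

text \<open>At a cut with all earlier values below all later ones, the values on either side form an
  interval. One side is proper with at least two entries, against simplicity.\<close>

lemma sum_indecomposable_simple:
  assumes simple: "simple_perm \<sigma>" and len: "4 \<le> length \<sigma>"
  shows "sum_indecomposable (diagram \<sigma>)"
proof (rule sum_indecomposable_diagram)
  fix m assume m: "0 < m" "m < length \<sigma>"
  let ?n = "length \<sigma>"
  define A B where "A = (!) \<sigma> ` {0..m - 1}" and "B = (!) \<sigma> ` {m..?n - 1}"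
  have set: "set \<sigma> = {1..?n}"
    using simple by (simp add: simple_perm_def is_perm_iff)
  have "{0..m - 1} \<union> {m..?n - 1} = {..<?n}"
    using m by auto
  then have AB: "A \<union> B = {1..?n}"
    unfolding A_def B_def image_Un[symmetric] set[symmetric] by (auto simp: set_conv_nth)
  show "\<exists>i<m. \<exists>j\<ge>m. j < ?n \<and> \<sigma> ! j \<le> \<sigma> ! i"
  proof (rule ccontr)
    assume "\<not> ?thesis"
    then have lt: "x < y" if xy: "x \<in> A" "y \<in> B" for x y
    proof -
      obtain i j where "i \<le> m - 1" "x = \<sigma> ! i" "m \<le> j" "j \<le> ?n - 1" "y = \<sigma> ! j"
        using xy by (auto simp: A_def B_def)
      then have "i < m" "m \<le> j" "j < ?n" "x = \<sigma> ! i" "y = \<sigma> ! j"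
        using m by auto
      then show ?thesis
        using \<open>\<not> (\<exists>i<m. \<exists>j\<ge>m. j < ?n \<and> \<sigma> ! j \<le> \<sigma> ! i)\<close> by (meson not_le)
    qed
    have fin: "finite A" "finite B" "A \<noteq> {}" "B \<noteq> {}"
      using m by (auto simp: A_def B_def)
    have "A = {1..Max A}"
    proof (intro equalityI subsetI)
      fix x assume x: "x \<in> {1..Max A}"
      then have "x \<in> A \<union> B"
        using AB fin Max_in[of A] by (metis UnI1 atLeastAtMost_iff order_trans)
      then show "x \<in> A"
        using lt[OF Max_in[OF fin(1,3)], of x] x by auto
    qed (use AB fin in auto)
    moreover have "B = {Min B..?n}"
    proof (intro equalityI subsetI)
      fix x assume x: "x \<in> {Min B..?n}"
      then have "x \<in> A \<union> B"
        using AB fin Min_in[of B] by (metis UnI2 atLeastAtMost_iff order_trans)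
      then show "x \<in> B"
        using lt[OF _ Min_in[OF fin(2,4)], of x] x by auto
    qed (use AB fin in auto)
    ultimately have int: "\<exists>a b. (!) \<sigma> ` {0..m - 1} = {a..b}" "\<exists>a b. (!) \<sigma> ` {m..?n - 1} = {a..b}"
      unfolding A_def B_def by blast+
    have trivial: "i = 0 \<and> j = ?n - 1" if "i < j" "j < ?n" "\<exists>a b. (!) \<sigma> ` {i..j} = {a..b}" for i j
      using simple that unfolding simple_perm_def by blast
    show False
    \<comment> \<open>Simplicity speaks of intervals with at least two entries. For
      \<open>m = 1\<close> the left side is a singleton, so the right side is used.\<close>
    proof (cases "m = 1")
      case True
      have "m = 0 \<and> ?n - 1 = ?n - 1"
        by (rule trivial[OF _ _ int(2)]) (use True len in simp_all)
      then show False
        using m by simp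
    next
      case False
      have "(0::nat) = 0 \<and> m - 1 = ?n - 1"
        by (rule trivial[OF _ _ int(1)]) (use m False in auto)
      then show False
        using m by simp
    qed
  qed
qed

text \<open>In \<open>[2,1]\<close>, \<open>[2,3,1]\<close> and \<open>[3,1,2]\<close> the first and
  last entries form an inversion across every cut, hence the fixed witnesses; \<open>[1]\<close> has
  no cut, and from size 4 on simplicity applies.\<close>

lemma increasing_oscillation_sum_indecomposable:
  assumes "increasing_oscillation \<sigma>"
  shows "is_perm \<sigma> \<and> \<sigma> \<noteq> [] \<and> sum_indecomposable (diagram \<sigma>)"
proof -
  consider "\<sigma> = [1]" | "\<sigma> = [2,1]" | "\<sigma> = [2,3,1]" | "\<sigma> = [3,1,2]"
    | "4 \<le> length \<sigma>" "simple_perm \<sigma>"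
    using assms unfolding increasing_oscillation_def by blast
  then show ?thesis
  proof cases
    case 1
    then show ?thesis
      by (auto simp: is_perm_iff intro: sum_indecomposable_diagram)
  next
    case 2
    have "sum_indecomposable (diagram \<sigma>)"
      by (rule sum_indecomposable_diagram, rule exI[of _ 0], simp add: 2, rule exI[of _ 1]) simp
    then show ?thesis
      using 2 by (auto simp: is_perm_iff)
  next
    case 3
    have "sum_indecomposable (diagram \<sigma>)"
      by (rule sum_indecomposable_diagram, rule exI[of _ 0], simp add: 3, rule exI[of _ 2]) simp
    then show ?thesis
      using 3 by (auto simp: is_perm_iff)
  next
    case 4
    have "sum_indecomposable (diagram \<sigma>)"
      by (rule sum_indecomposable_diagram, rule exI[of _ 0], simp add: 4, rule exI[of _ 2]) simp
    then show ?thesis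
      using 4 by (auto simp: is_perm_iff)
  next
    case 5
    then show ?thesis
      using sum_indecomposable_simple by (auto simp: simple_perm_def)
  qed
qed

section \<open>The shuffle product\<close>

lemma conc_assoc: "(X \<cdot> Y) \<cdot> Z = X \<cdot> (Y \<cdot> Z)"
  unfolding conc_def by (auto; metis append.assoc)

lemma conc_Un: "X \<cdot> (Y \<union> Z) = X \<cdot> Y \<union> X \<cdot> Z"
  unfolding conc_def by blast

lemma conc_UN: "(\<Union>i\<in>I. X i) \<cdot> Z = (\<Union>i\<in>I. X i \<cdot> Z)"
  unfolding conc_def by blast

lemma conc_empty: "X \<cdot> {} = {}"
  unfolding conc_def by blast

lemma conc_unit: "X \<cdot> {[]} = X"
  unfolding conc_def by simp

text \<open>Indices beyond the list select nothing, so index sets may be trimmed.\<close>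

lemma nths_Int_length: "nths xs (I \<inter> {..<length xs}) = nths xs I"
  unfolding nths_def by (intro arg_cong[of _ _ "map fst"] filter_cong) (auto dest: set_zip_rightD)

lemma shuffle_productI:
  assumes "length c = length A + length B" "I \<inter> J = {}" "I \<union> J = {..<length c}"
    "list_all2 (\<in>) (nths c I) A" "list_all2 (\<in>) (nths c J) B"
  shows "concat c \<in> shuffle_product A B"
  using assms unfolding shuffle_product_def by blast

text \<open>By exchanging \<open>I\<close> and \<open>J\<close>; this leaves only the first sequence
  to be treated below.\<close>

lemma shuffle_product_commute: "shuffle_product A B = shuffle_product B A"
proof -
  have "shuffle_product A B \<subseteq> shuffle_product B A" for A B :: "'a list set list"
    unfolding shuffle_product_def by (auto simp: add.commute) (metis Int_commute Un_commute)
  then show ?thesis by blast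
qed

text \<open>The new factor takes the index \<open>length c\<close>, which joins
  \<open>I\<close>.\<close>

lemma shuffle_product_snocI:
  assumes "u \<in> shuffle_product A B" "x \<in> X"
  shows "u @ x \<in> shuffle_product (A @ [X]) B"
proof -
  obtain c I J where c: "u = concat c" "length c = length A + length B" "I \<inter> J = {}" "I \<union> J = {..<length c}"
    "list_all2 (\<in>) (nths c I) A" "list_all2 (\<in>) (nths c J) B"
    using assms(1) unfolding shuffle_product_def by blast
  let ?n = "length c"
  have I: "I \<subseteq> {..<?n}" "J \<subseteq> {..<?n}"
    using c(4) by auto
  have "nths c (insert ?n I) = nths c I"
    using nths_Int_length[of c "insert ?n I"] nths_Int_length[of c I] by simp
  then have "nths (c @ [x]) (insert ?n I) = nths c I @ [x]" "nths (c @ [x]) J = nths c J"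
    using I by (auto simp: nths_append)
  then have "list_all2 (\<in>) (nths (c @ [x]) (insert ?n I)) (A @ [X])" "list_all2 (\<in>) (nths (c @ [x]) J) B"
    using c assms(2) by (simp_all add: list_all2_appendI)
  moreover have "insert ?n I \<inter> J = {}" "insert ?n I \<union> J = {..<length (c @ [x])}"
    using c(3,4) I by auto
  ultimately have "concat (c @ [x]) \<in> shuffle_product (A @ [X]) B"
    using c(2) by (intro shuffle_productI) simp_all
  then show ?thesis
    using c(1) by simp
qed

text \<open>The last index lies in \<open>I\<close> or in \<open>J\<close>, so the last factor comes
  from the last set of \<open>A\<close> or of \<open>B\<close>, and deleting it leaves a shuffle of
  the other sets. The auxiliary fact treats \<open>I\<close>; exchanging the two sequences covers
  \<open>J\<close>.\<close>

lemma shuffle_product_lastE: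
  assumes "w \<in> shuffle_product A B" "A \<noteq> [] \<or> B \<noteq> []"
  shows "(A \<noteq> [] \<and> w \<in> shuffle_product (butlast A) B \<cdot> last A) \<or>
    (B \<noteq> [] \<and> w \<in> shuffle_product A (butlast B) \<cdot> last B)"
proof -
  have *: "A \<noteq> [] \<and> concat (c @ [x]) \<in> shuffle_product (butlast A) B \<cdot> last A"
    if c: "Suc (length c) = length A + length B" "I \<inter> J = {}" "I \<union> J = {..<Suc (length c)}"
      "list_all2 (\<in>) (nths (c @ [x]) I) A" "list_all2 (\<in>) (nths (c @ [x]) J) B" "length c \<in> I"
    for c :: "'a list list" and x I J A B
  proof -
    let ?n = "length c"
    have "nths (c @ [x]) I = nths c I @ [x]" "nths (c @ [x]) J = nths c J"
      using c by (auto simp: nths_append)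
    then have I: "list_all2 (\<in>) (nths c I @ [x]) A" and J: "list_all2 (\<in>) (nths c J) B"
      using c by auto
    from I obtain A' X where A: "A = A' @ [X]" "list_all2 (\<in>) (nths c I) A'" "x \<in> X"
      by (auto simp: list_all2_append1 list_all2_Cons1)
    have "(I \<inter> {..<?n}) \<inter> J = {}" "(I \<inter> {..<?n}) \<union> J = {..<?n}"
      using c(2,3,6) unfolding lessThan_Suc by blast+
    moreover have "list_all2 (\<in>) (nths c (I \<inter> {..<?n})) A'"
      using A(2) by (simp only: nths_Int_length)
    ultimately have "concat c \<in> shuffle_product A' B"
      using A(1) J c(1) by (intro shuffle_productI[of c A' B "I \<inter> {..<?n}" J]) simp_all
    then show ?thesis
      using A unfolding conc_def by auto
  qed
  obtain c I J where c: "w = concat c" "length c = length A + length B" "I \<inter> J = {}" "I \<union> J = {..<length c}"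
    "list_all2 (\<in>) (nths c I) A" "list_all2 (\<in>) (nths c J) B"
    using assms(1) unfolding shuffle_product_def by blast
  have "c \<noteq> []"
    using c(2) assms(2) by auto
  then obtain c' x where c': "c = c' @ [x]"
    by (metis append_butlast_last_id)
  have "length c' \<in> I \<or> length c' \<in> J"
    using c(4) c' by auto
  then show ?thesis
  proof
    assume "length c' \<in> I"
    then show ?thesis
      using *[of c' A B I J x] c c' by simp
  next
    assume "length c' \<in> J"
    then have "B \<noteq> [] \<and> w \<in> shuffle_product (butlast B) A \<cdot> last B"
      using *[of c' B A J I x] c c' by (simp add: Int_commute Un_commute add.commute)
    then show ?thesis
      by (simp add: shuffle_product_commute)
  qed
qed

lemma shuffle_product_Nil: "shuffle_product [] [] = {[]}"
  unfolding shuffle_product_def by auto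

lemma shuffle_product_last:
  assumes "A \<noteq> [] \<or> B \<noteq> []"
  shows "shuffle_product A B =
    (if A = [] then {} else shuffle_product (butlast A) B \<cdot> last A) \<union>
    (if B = [] then {} else shuffle_product A (butlast B) \<cdot> last B)" (is "_ = ?R")
proof
  show "shuffle_product A B \<subseteq> ?R"
    using shuffle_product_lastE[OF _ assms] by fastforce
  have "shuffle_product (butlast A) B \<cdot> last A \<subseteq> shuffle_product A B" if "A \<noteq> []" for A B :: "'a list set list"
    using shuffle_product_snocI[of _ "butlast A" B _ "last A"] that unfolding conc_def by auto
  from this[of A B] this[of B A] show "?R \<subseteq> shuffle_product A B"
    unfolding shuffle_product_commute[of B A] shuffle_product_commute[of "butlast B" A]
    by (cases "A = []"; cases "B = []") simp_all
qed

text \<open>Both bounds vary, because the recursion removes block \<open>l\<close> or block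
  \<open>m\<close>. With just two blocks, both sequences are empty and their shuffle contains only
  the empty word.\<close>

lemma pin_words_direct_sum_interval:
  fixes \<xi> :: "nat \<Rightarrow> nat list"
  assumes "\<And>i. i \<in> {l..m} \<Longrightarrow> is_perm (\<xi> i) \<and> \<xi> i \<noteq> [] \<and> sum_indecomposable (diagram (\<xi> i))"
    and "l < m"
  shows "pin_words (direct_sum (map \<xi> [l..<m + 1])) =
    (\<Union>i\<in>{l..m - 1}. pin_words (direct_sum [\<xi> i, \<xi> (i + 1)]) \<cdot>
       shuffle_product
         (map (\<lambda>j. pin_words_quadrant Q1 (\<xi> j)) (rev [l..<i]))
         (map (\<lambda>j. pin_words_quadrant Q3 (\<xi> j)) [i + 2..<m + 1]))"
  using assms
proof (induction "m - l" arbitrary: l m rule: less_induct)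
  case less
  define V where "V i = pin_words (direct_sum [\<xi> i, \<xi> (i + 1)])" for i
  define Sh where "Sh l m i = shuffle_product
    (map (\<lambda>j. pin_words_quadrant Q1 (\<xi> j)) (rev [l..<i]))
    (map (\<lambda>j. pin_words_quadrant Q3 (\<xi> j)) [i + 2..<m + 1])" for l m i
  show ?case
  proof (cases "m = l + 1")
    case True
    then show ?thesis
      by (simp add: upt_rec[of l] shuffle_product_Nil conc_unit)
  next
    case False
    then have m: "l + 2 \<le> m"
      using less.prems by simp
    let ?W = "pin_words (direct_sum (map \<xi> [l..<m + 1]))"
    let ?P = "pin_words_quadrant Q1 (\<xi> l)" and ?Q = "pin_words_quadrant Q3 (\<xi> m)"
    have IH1: "pin_words (direct_sum (map \<xi> [l + 1..<m + 1])) = (\<Union>i\<in>{l + 1..m - 1}. V i \<cdot> Sh (l + 1) m i)"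
      unfolding V_def Sh_def using m by (intro less.hyps less.prems(1)) auto
    have "pin_words (direct_sum (map \<xi> [l..<m - 1 + 1])) = (\<Union>i\<in>{l..m - 1 - 1}. V i \<cdot> Sh l (m - 1) i)"
      unfolding V_def Sh_def using m by (intro less.hyps less.prems(1)) auto
    moreover have "m - 1 + 1 = m" "m - 1 - 1 = m - 2"
      using m by auto
    ultimately have IH2: "pin_words (direct_sum (map \<xi> [l..<m])) = (\<Union>i\<in>{l..m - 2}. V i \<cdot> Sh l (m - 1) i)"
      by simp
    \<comment> \<open>The first sequence runs down to \<open>l\<close> and the second up to
      \<open>m\<close>, so their last sets belong to the outermost blocks. The first is empty for
      \<open>i = l\<close>, the second for \<open>i = m - 1\<close>.\<close>
    have Sh: "Sh l m i = (if i = l then {} else Sh (l + 1) m i \<cdot> ?P) \<union>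
      (if i = m - 1 then {} else Sh l (m - 1) i \<cdot> ?Q)" if "i \<in> {l..m - 1}" for i
    proof -
      have "[l..<i] = (if i = l then [] else l # [l + 1..<i])"
        using that by (simp add: upt_rec)
      moreover have "[i + 2..<m + 1] = (if i = m - 1 then [] else [i + 2..<m] @ [m])"
        using that m by auto
      ultimately show ?thesis
        unfolding Sh_def using that m
        by (subst shuffle_product_last) (auto simp: butlast_append simp del: upt_Suc)
    qed
    have "?W = pin_words (direct_sum (map \<xi> [l + 1..<m + 1])) \<cdot> ?P \<union> pin_words (direct_sum (map \<xi> [l..<m])) \<cdot> ?Q"
    proof (subst pin_words_direct_sum_step)
      show "is_perm \<xi>' \<and> \<xi>' \<noteq> [] \<and> sum_indecomposable (diagram \<xi>')" if "\<xi>' \<in> set (map \<xi> [l..<m + 1])" for \<xi>'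
        using that less.prems(1) by auto
    qed (use m in \<open>simp_all add: hd_map last_map map_tl[symmetric] map_butlast[symmetric] tl_upt\<close>)
    also have "\<dots> = (\<Union>i\<in>{l + 1..m - 1}. V i \<cdot> (Sh (l + 1) m i \<cdot> ?P)) \<union> (\<Union>i\<in>{l..m - 2}. V i \<cdot> (Sh l (m - 1) i \<cdot> ?Q))"
      unfolding IH1 IH2 conc_UN conc_assoc ..
    also have "\<dots> = (\<Union>i\<in>{l..m - 1}. V i \<cdot> Sh l m i)"
    proof -
      \<comment> \<open>Discarding the empty terms at \<open>i = l\<close> and
        \<open>i = m - 1\<close> leaves the index ranges of the two induction hypotheses.\<close>
      have "(\<Union>i\<in>{l..m - 1}. V i \<cdot> Sh l m i) =
        (\<Union>i\<in>{l..m - 1}. if i = l then {} else V i \<cdot> (Sh (l + 1) m i \<cdot> ?P)) \<union>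
        (\<Union>i\<in>{l..m - 1}. if i = m - 1 then {} else V i \<cdot> (Sh l (m - 1) i \<cdot> ?Q))"
        unfolding UN_Un_distrib[symmetric] by (intro SUP_cong) (simp_all add: Sh conc_Un conc_empty)
      moreover have "(\<Union>i\<in>S. if i = a then {} else F i) = (\<Union>i\<in>S - {a}. F i)"
        for S a and F :: "nat \<Rightarrow> letter list set"
        by (auto split: if_splits)
      moreover have "{l..m - 1} - {l} = {l + 1..m - 1}" "{l..m - 1} - {m - 1} = {l..m - 2}"
        using m by auto
      ultimately show ?thesis by simp
    qed
    finally show ?thesis
      unfolding V_def Sh_def .
  qed
qed

theorem theoremB12:
  fixes \<xi> :: "nat \<Rightarrow> nat list" and r :: nat and \<pi> :: "nat list"
  assumes "r \<ge> 2"
    and "\<And>i. i \<in> {1..r} \<Longrightarrow> increasing_oscillation (\<xi> i)"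
    and "\<pi> = direct_sum (map \<xi> [1..<r + 1])"
  shows "pin_words \<pi> =
    (\<Union>i\<in>{1..r - 1}. pin_words (direct_sum [\<xi> i, \<xi> (i + 1)]) \<cdot>
       shuffle_product
         (map (\<lambda>j. pin_words_quadrant Q1 (\<xi> j)) (rev [1..<i]))
         (map (\<lambda>j. pin_words_quadrant Q3 (\<xi> j)) [i + 2..<r + 1]))"
  unfolding assms(3)
  using assms(1,2) increasing_oscillation_sum_indecomposable
  by (intro pin_words_direct_sum_interval) auto

end
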